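(* Consider the stochastic teams $(\mathcal{P}^D)$, $(\mathcal{P}^S)$, $(\mathcal{P}^{D,CS})$ and $(\mathcal{P}^{CS})$ with partially nested information structure, associated with observations $\hat y^D_i=g_i(h_i(\zeta),u^{\downarrow i})$ and $\hat y^S_i=h_i(\zeta)$. (i) Suppose that for all $i\in\mathcal{N}$ and every fixed $u^{\downarrow i}$ the function $g_i(\cdot,u^{\downarrow i}):h_i(\zeta)\mapsto\hat y^D_i$ is invertible for all realizations of $\zeta$. Let $\underline\gamma^{D,CS}\in\Gamma^{D,CS}$ and $\underline\gamma^{CS}\in\Gamma^{CS}$ be related by the static measurements with control-sharing reduction, i.e. $\gamma^{D,CS}_i(y^{D,CS}_i)=\gamma^{CS}_i(y^{CS}_i)$ for every $u^{\downarrow i}$ $P$-a.s., for all $i\in\mathcal{N}$. Then $\underline\gamma^{D,CS}$ is pbp optimal (respectively, stationary, globally optimal) for $(\mathcal{P}^{D,CS})$ if and only if $\underline\gamma^{CS}$ is pbp optimal (respectively, stationary, globally optimal) for $(\mathcal{P}^{CS})$. (ii) Any pbp optimal (respectively, stationary) policy $\underline\gamma^{D*}\in\Gamma^D$ for $(\mathcal{P}^D)$ constitutes a pbp optimal (respectively, stationary) policy on the enlarged space $\Gamma^{D,CS}$ for $(\mathcal{P}^{D,CS})$. However, in general, if $\underline\gamma^{D,CS*}\in\Gamma^{D,CS}$ is pbp optimal (respectively, stationary) for $(\mathcal{P}^{D,CS})$, then $\underline\gamma^{D*}\in\Gamma^D$ satisfying $\gamma^{D*}_i(y^D_i)=\gamma^{D,CS*}_i(y^{D,CS}_i)$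 $P$-a.s. for all $i\in\mathcal{N}$ is not necessarily pbp optimal (respectively, stationary) for $(\mathcal{P}^D)$. (iii) Any pbp optimal (respectively, stationary) policy $\underline\gamma^{S*}\in\Gamma^S$ for $(\mathcal{P}^S)$ constitutes a pbp optimal (respectively, stationary) policy on the enlarged space $\Gamma^{CS}$ for $(\mathcal{P}^{CS})$. However, in general, if $\underline\gamma^{CS*}\in\Gamma^{CS}$ is pbp optimal (respectively, stationary) for $(\mathcal{P}^{CS})$, then $\underline\gamma^{S*}\in\Gamma^S$ satisfying $\gamma^{S*}_i(y^S_i)=\gamma^{CS*}_i(y^{CS}_i)$ $P$-a.s. for all $i\in\mathcal{N}$ is not necessarily pbp optimal (respectively, stationary) for $(\mathcal{P}^S)$.
   Context: Setting. $\mathcal{N}=\{1,\dots,N\}$; the decision makers DM$^1,\dots,$DM$^N$ act in this order, each once. Action spaces $\mathbb{U}^i\subseteq\mathbb{R}^{n_i}$ and observation spaces are Borel subsets of Euclidean spaces. $\zeta=\{\omega_0,\dots,\omega_N\}$ is the collection of all primitive random variables on $(\Omega,\mathcal{F},P)$, $\omega_0$ taking values in a Borel space $\Omega_0$. The cost is a Borel function $c:\Omega_0\times\prod_i\mathbb{U}^i\to\mathbb{R}_+$, and $J(\underline\gamma)=E[c(\omega_0,u^1,\dots,u^N)]$ when actions are generated by $\underline\gamma$. All policies are deterministic and measurable. Observations. $\hat y^D_i=g_i(h_i(\zeta),u^{\downarrow i})$ with $g_i,h_i$ measurable, $\downarrow i=\{j: \hat y^D_i\text{ is affected by }u^j\}$,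 $u^{\downarrow i}=(u^j)_{j\in\downarrow i}$ (similarly $y_{\downarrow i}$); $\hat y^S_i=h_i(\zeta)$. The information structure is partially nested: whenever the action of DM$^k$, $k<i$, affects the information of DM$^i$, the information of DM$^i$ includes that of DM$^k$. The four problems all have expected cost $J$ with the same $c$ and differ only in the information of DM$^i$: - $(\mathcal{P}^D)$: $y^D_i=\{y^D_{\downarrow i},\hat y^D_i\}$, policies $\Gamma^D$; - $(\mathcal{P}^S)$: $y^S_i=\{y^S_{\downarrow i},\hat y^S_i\}$, policies $\Gamma^S$; - $(\mathcal{P}^{D,CS})$: $y^{D,CS}_i=\{y^D_{\downarrow i},u^{\downarrow i},\hat y^D_i\}$, policies $\Gamma^{D,CS}$; - $(\mathcal{P}^{CS})$: $y^{CS}_i=\{y^S_{\downarrow i},u^{\downarrow i},\hat y^S_i\}$, policies $\Gamma^{CS}$; where in each case a policy is $\underline\gamma=(\gamma_1,\dots,\gamma_N)$ with $u^i$ equal to $\gamma_i$ evaluated at the information of DM$^i$. A policy in $\Gamma^D$ (resp. $\Gamma^S$) is regarded as a policy in $\Gamma^{D,CS}$ (resp. $\Gamma^{CS}$) not using the extra information $u^{\downarrow i}$. "For every $u^{\downarrow i}$" means that $u^{\downarrow i}$ is treated as a free variable entering both information variables. Optimality concepts, for each problem with its own policy space. $\underline\gamma^*$ is globally optimal if $J(\underline\gamma^* )=\inf J(\underline\gamma)$ over all admissible policies; pbp (person-by-person) optimal if, for every $i$, $J(\underline\gamma^* )=\inf_{\gamma_i}J(\gamma_i,\underline\gamma^*_{-i})$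 over admissible policies of DM$^i$ with the others fixed; stationary if for every $i$, $P$-a.s., $\nabla_{u^i}E[c(\omega_0,(\underline\gamma^*_{-i}(y_{-i}),u^i))\mid y_i]|_{u^i=\gamma^*_i(y_i)}=0$, where $y_j$ denotes the information of DM$^j$ in the problem at hand and, whenever the information of a later DM$^j$ depends on the action of DM$^i$ (through observations and/or shared controls), it is evaluated with that action equal to $u^i$. "Not necessarily" means that there exist a team and policies (with the invertibility property of part (i)) for which the implication fails. *)

theory Defs
  imports "HOL-Probability.Probability"
begin

text \<open>
  The data of a sequential team, common to the four problems below.  The decision makers are
  \<open>1, \<dots>, num_dms\<close> and act in this order.  Spaces of varying dimension are Borel subsets of one
  ambient type each: \<open>'z\<close> (primitive random variables), \<open>'y\<close> (observations), \<open>'u\<close> (actions).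
  The linear subspace \<open>act_euclid i\<close> of \<open>'u\<close> stands for $\mathbb{R}^{n_i}$; only there is the linear
  structure used, for gradients with respect to $u^i$.  The set \<open>down i\<close> is $\downarrow i$.
\<close>

record ('w, 'z, 'y, 'u) team =
  num_dms :: nat
  prim_prob :: "'w measure"
  prim_set :: "nat \<Rightarrow> 'z set"
  prim_rv :: "nat \<Rightarrow> 'w \<Rightarrow> 'z"
  act_euclid :: "nat \<Rightarrow> 'u set"
  act_set :: "nat \<Rightarrow> 'u set"
  stat_obs_set :: "nat \<Rightarrow> 'y set"
  dyn_obs_set :: "nat \<Rightarrow> 'y set"
  down :: "nat \<Rightarrow> nat set"
  stat_obs :: "nat \<Rightarrow> (nat \<Rightarrow> 'z) \<Rightarrow> 'y"  \<comment> \<open>$h_i$\<close>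
  dyn_obs :: "nat \<Rightarrow> 'y \<Rightarrow> (nat \<Rightarrow> 'u) \<Rightarrow> 'y"  \<comment> \<open>$g_i$\<close>
  cost :: "'z \<Rightarrow> (nat \<Rightarrow> 'u) \<Rightarrow> real"

abbreviation dms :: "('w, 'z, 'y, 'u) team \<Rightarrow> nat set" where
  "dms T \<equiv> {1..num_dms T}"

definition prim_space :: "('w, 'z::polish_space, 'y, 'u) team \<Rightarrow> nat \<Rightarrow> 'z measure" where
  "prim_space T k = restrict_space borel (prim_set T k)"

definition zeta_space :: "('w, 'z::polish_space, 'y, 'u) team \<Rightarrow> (nat \<Rightarrow> 'z) measure" where
  "zeta_space T = PiM {0..num_dms T} (prim_space T)"

definition zeta :: "('w, 'z, 'y, 'u) team \<Rightarrow> 'w \<Rightarrow> nat \<Rightarrow> 'z" where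
  "zeta T w = (\<lambda>k\<in>{0..num_dms T}. prim_rv T k w)"

definition act_space :: "('w, 'z, 'y, 'u::euclidean_space) team \<Rightarrow> nat \<Rightarrow> 'u measure" where
  "act_space T i = restrict_space borel (act_set T i)"

definition stat_obs_space :: "('w, 'z, 'y::euclidean_space, 'u) team \<Rightarrow> nat \<Rightarrow> 'y measure" where
  "stat_obs_space T i = restrict_space borel (stat_obs_set T i)"

definition dyn_obs_space :: "('w, 'z, 'y::euclidean_space, 'u) team \<Rightarrow> nat \<Rightarrow> 'y measure" where
  "dyn_obs_space T i = restrict_space borel (dyn_obs_set T i)"

text \<open>
  The last clause on \<open>down\<close> says that the action of every DM in $\downarrow i$ really affects
  $\hat y^D_i = g_i(h_i(\zeta), u^{\downarrow i})$.
\<close>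

definition is_team ::
  "('w, 'z::polish_space, 'y::euclidean_space, 'u::euclidean_space) team \<Rightarrow> bool" where
  "is_team T \<longleftrightarrow>
     prob_space (prim_prob T) \<and>
     (\<forall>k\<in>{0..num_dms T}. prim_set T k \<in> sets borel \<and>
        prim_rv T k \<in> prim_prob T \<rightarrow>\<^sub>M prim_space T k) \<and>
     (\<forall>i\<in>dms T.
        subspace (act_euclid T i) \<and> act_set T i \<subseteq> act_euclid T i \<and>
        act_set T i \<in> sets borel \<and> stat_obs_set T i \<in> sets borel \<and> dyn_obs_set T i \<in> sets borel \<and>
        stat_obs T i \<in> zeta_space T \<rightarrow>\<^sub>M stat_obs_space T i \<and>
        (\<lambda>(s, u). dyn_obs T i s u)
          \<in> stat_obs_space T i \<Otimes>\<^sub>M PiM (down T i) (act_space T) \<rightarrow>\<^sub>M dyn_obs_space T i \<and>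
        down T i \<subseteq> {1..<i} \<and>
        (\<forall>j\<in>down T i. \<exists>z\<in>space (zeta_space T). \<exists>u\<in>PiE (down T i) (act_set T). \<exists>v\<in>act_set T j.
           dyn_obs T i (stat_obs T i z) (u(j := v)) \<noteq> dyn_obs T i (stat_obs T i z) u)) \<and>
     (\<lambda>(x, u). cost T x u)
       \<in> prim_space T 0 \<Otimes>\<^sub>M PiM (dms T) (act_space T) \<rightarrow>\<^sub>M borel \<and>
     (\<forall>x\<in>prim_set T 0. \<forall>u\<in>PiE (dms T) (act_set T). 0 \<le> cost T x u)"

text \<open>
  \<open>PD\<close>, \<open>PS\<close>, \<open>PDCS\<close>, \<open>PCS\<close> are the problems $(\mathcal{P}^D)$, $(\mathcal{P}^S)$,
  $(\mathcal{P}^{D,CS})$ and $(\mathcal{P}^{CS})$.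
\<close>

datatype problem = PD | PS | PDCS | PCS

definition dynamic :: "problem \<Rightarrow> bool" where
  "dynamic p \<longleftrightarrow> p = PD \<or> p = PDCS"

definition control_sharing :: "problem \<Rightarrow> bool" where
  "control_sharing p \<longleftrightarrow> p = PDCS \<or> p = PCS"

definition obs :: "('w, 'z, 'y, 'u) team \<Rightarrow> problem \<Rightarrow> nat \<Rightarrow> (nat \<Rightarrow> 'z) \<Rightarrow> (nat \<Rightarrow> 'u) \<Rightarrow> 'y" where
  "obs T p i z u =
     (if dynamic p then dyn_obs T i (stat_obs T i z) (restrict u (down T i)) else stat_obs T i z)"

definition obs_space ::
  "('w, 'z, 'y::euclidean_space, 'u) team \<Rightarrow> problem \<Rightarrow> nat \<Rightarrow> 'y measure" where
  "obs_space T p = (if dynamic p then dyn_obs_space T else stat_obs_space T)"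

text \<open>
  Unfolding the recursion $y_i = \{y_{\downarrow i}, \hat y_i\}$, the observations contained in $y_i$
  are the $\hat y_j$ with \<open>j\<close> reachable from \<open>i\<close> along $\downarrow$ (including \<open>i\<close>).
\<close>

definition obs_idx :: "('w, 'z, 'y, 'u) team \<Rightarrow> nat \<Rightarrow> nat set" where
  "obs_idx T i = {j. (i, j) \<in> {(a, b). b \<in> down T a}\<^sup>*}"

definition shared_idx :: "('w, 'z, 'y, 'u) team \<Rightarrow> problem \<Rightarrow> nat \<Rightarrow> nat set" where
  "shared_idx T p i = (if control_sharing p then down T i else {})"

definition info ::
  "('w, 'z, 'y, 'u) team \<Rightarrow> problem \<Rightarrow> nat \<Rightarrow> (nat \<Rightarrow> 'z) \<Rightarrow> (nat \<Rightarrow> 'u)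
     \<Rightarrow> (nat \<Rightarrow> 'y) \<times> (nat \<Rightarrow> 'u)" where
  "info T p i z u = (\<lambda>j\<in>obs_idx T i. obs T p j z u, restrict u (shared_idx T p i))"

definition info_space ::
  "('w, 'z, 'y::euclidean_space, 'u::euclidean_space) team \<Rightarrow> problem \<Rightarrow> nat
     \<Rightarrow> ((nat \<Rightarrow> 'y) \<times> (nat \<Rightarrow> 'u)) measure" where
  "info_space T p i =
     PiM (obs_idx T i) (obs_space T p) \<Otimes>\<^sub>M PiM (shared_idx T p i) (act_space T)"

text \<open>The DMs whose actions affect the information of DM \<open>i\<close>.\<close>

definition affecting :: "('w, 'z, 'y, 'u) team \<Rightarrow> problem \<Rightarrow> nat \<Rightarrow> nat set" where
  "affecting T p i =
     (if dynamic p then (\<Union>j\<in>obs_idx T i. down T j) else {}) \<union> shared_idx T p i"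

text \<open>
  Automatic for \<open>PD\<close> and \<open>PS\<close>.  For the control-sharing problems it forces \<open>down\<close> to be transitive,
  since the information of DM \<open>k\<close> then contains the actions $u^{\downarrow k}$.
\<close>

definition partially_nested :: "('w, 'z, 'y, 'u) team \<Rightarrow> problem \<Rightarrow> bool" where
  "partially_nested T p \<longleftrightarrow>
     (\<forall>i\<in>dms T. \<forall>k\<in>affecting T p i.
        obs_idx T k \<subseteq> obs_idx T i \<and> shared_idx T p k \<subseteq> shared_idx T p i)"

text \<open>
  Invertibility of $g_i(\cdot, u^{\downarrow i})$ as a map on the values of $h_i(\zeta)$, onto its
  image.
\<close>

definition invertible_obs ::
  "('w, 'z::polish_space, 'y, 'u) team \<Rightarrow> bool" where
  "invertible_obs T \<longleftrightarrow>
     (\<forall>i\<in>dms T. \<forall>u\<in>PiE (down T i) (act_set T).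
        inj_on (\<lambda>s. dyn_obs T i s u) (stat_obs T i ` space (zeta_space T)))"

type_synonym ('y, 'u) policy = "nat \<Rightarrow> (nat \<Rightarrow> 'y) \<times> (nat \<Rightarrow> 'u) \<Rightarrow> 'u"

definition dm_policies ::
  "('w, 'z, 'y::euclidean_space, 'u::euclidean_space) team \<Rightarrow> problem \<Rightarrow> nat
     \<Rightarrow> ((nat \<Rightarrow> 'y) \<times> (nat \<Rightarrow> 'u) \<Rightarrow> 'u) set" where
  "dm_policies T p i = info_space T p i \<rightarrow>\<^sub>M act_space T i"

definition policies ::
  "('w, 'z, 'y::euclidean_space, 'u::euclidean_space) team \<Rightarrow> problem \<Rightarrow> ('y, 'u) policy set" where
  "policies T p = {\<gamma>. \<forall>i\<in>dms T. \<gamma> i \<in> dm_policies T p i}"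

text \<open>
  A policy without control sharing, regarded as a control-sharing policy.  In \<open>PD\<close> and \<open>PS\<close> the
  action component of the information is always the function on the empty index set.
\<close>

definition ignore_controls :: "('y, 'u) policy \<Rightarrow> ('y, 'u) policy" where
  "ignore_controls \<gamma> = (\<lambda>i (y, a). \<gamma> i (y, restrict a {}))"

text \<open>The actions of the first \<open>k\<close> decision makers.\<close>

primrec actions ::
  "('w, 'z, 'y, 'u) team \<Rightarrow> problem \<Rightarrow> ('y, 'u) policy \<Rightarrow> (nat \<Rightarrow> 'z) \<Rightarrow> nat \<Rightarrow> nat \<Rightarrow> 'u" where
  "actions T p \<gamma> z 0 = (\<lambda>_. undefined)"
| "actions T p \<gamma> z (Suc k) =
     (actions T p \<gamma> z k)(Suc k := \<gamma> (Suc k) (info T p (Suc k) z (actions T p \<gamma> z k)))"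

definition play ::
  "('w, 'z, 'y, 'u) team \<Rightarrow> problem \<Rightarrow> ('y, 'u) policy \<Rightarrow> (nat \<Rightarrow> 'z) \<Rightarrow> nat \<Rightarrow> 'u" where
  "play T p \<gamma> z = actions T p \<gamma> z (num_dms T)"

definition closed_info ::
  "('w, 'z, 'y, 'u) team \<Rightarrow> problem \<Rightarrow> ('y, 'u) policy \<Rightarrow> nat \<Rightarrow> (nat \<Rightarrow> 'z)
     \<Rightarrow> (nat \<Rightarrow> 'y) \<times> (nat \<Rightarrow> 'u)" where
  "closed_info T p \<gamma> i z = info T p i z (play T p \<gamma> z)"

definition closed_cost ::
  "('w, 'z, 'y, 'u) team \<Rightarrow> problem \<Rightarrow> ('y, 'u) policy \<Rightarrow> (nat \<Rightarrow> 'z) \<Rightarrow> ennreal" where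
  "closed_cost T p \<gamma> z = ennreal (cost T (z 0) (play T p \<gamma> z))"

definition J :: "('w, 'z, 'y, 'u) team \<Rightarrow> problem \<Rightarrow> ('y, 'u) policy \<Rightarrow> ennreal" where
  "J T p \<gamma> = (\<integral>\<^sup>+ w. closed_cost T p \<gamma> (zeta T w) \<partial>prim_prob T)"

text \<open>
  Every random variable of the problems is a function of $\zeta$; conditional expectations and
  almost sure statements are taken under the law of $\zeta$.
\<close>

definition zeta_law :: "('w, 'z::polish_space, 'y, 'u) team \<Rightarrow> (nat \<Rightarrow> 'z) measure" where
  "zeta_law T = distr (prim_prob T) (zeta_space T) (zeta T)"

definition globally_optimal ::
  "('w, 'z, 'y::euclidean_space, 'u::euclidean_space) team \<Rightarrow> problem \<Rightarrow> ('y, 'u) policy \<Rightarrow> bool" where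
  "globally_optimal T p \<gamma> \<longleftrightarrow> \<gamma> \<in> policies T p \<and> J T p \<gamma> = (INF \<beta>\<in>policies T p. J T p \<beta>)"

definition pbp_optimal ::
  "('w, 'z, 'y::euclidean_space, 'u::euclidean_space) team \<Rightarrow> problem \<Rightarrow> ('y, 'u) policy \<Rightarrow> bool" where
  "pbp_optimal T p \<gamma> \<longleftrightarrow>
     \<gamma> \<in> policies T p \<and>
     (\<forall>i\<in>dms T. J T p \<gamma> = (INF \<beta>\<in>dm_policies T p i. J T p (\<gamma>(i := \<beta>))))"

text \<open>
  Stationarity differentiates $u \mapsto E[c(\dots, u) \mid y_i]$, so versions of these uncountably
  many conditional expectations must be chosen coherently in \<open>u\<close>: they are integrals against a
  regular conditional distribution \<open>\<kappa>\<close> of $\zeta$ given $y_i$.  In the present setting of Borel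
  spaces such a \<open>\<kappa>\<close> exists and is unique up to a null set of values of $y_i$.
\<close>

definition regular_cond_distr :: "'a measure \<Rightarrow> 'b measure \<Rightarrow> ('a \<Rightarrow> 'b) \<Rightarrow> ('b \<Rightarrow> 'a measure) \<Rightarrow> bool" where
  "regular_cond_distr M N Y \<kappa> \<longleftrightarrow>
     \<kappa> \<in> N \<rightarrow>\<^sub>M prob_algebra M \<and>
     (\<forall>B\<in>sets M. AE x in M.
        emeasure (\<kappa> (Y x)) B = nn_cond_exp M (vimage_algebra (space M) Y N) (indicator B) x)"

text \<open>
  The gradient at \<open>x\<close> of a function on \<open>A\<close>, a subset of the Euclidean space \<open>E\<close>, vanishes; this
  includes that \<open>x\<close> is interior to \<open>A\<close> relative to \<open>E\<close> and that the function is finite near \<open>x\<close>.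
\<close>

definition zero_gradient ::
  "'u::euclidean_space set \<Rightarrow> 'u set \<Rightarrow> ('u \<Rightarrow> ennreal) \<Rightarrow> 'u \<Rightarrow> bool" where
  "zero_gradient E A f x \<longleftrightarrow>
     (\<exists>S. openin (top_of_set E) S \<and> x \<in> S \<and> S \<subseteq> A \<and> (\<forall>v\<in>S. f v < \<top>) \<and>
        ((\<lambda>v. enn2real (f v)) has_derivative (\<lambda>_. 0)) (at x within S))"

text \<open>
  Fixing the policy of DM \<open>i\<close> to the constant \<open>u\<close> makes the information of the later DMs react to
  \<open>u\<close>, while $y_i$ itself and the earlier actions do not change.
\<close>

definition stationary ::
  "('w, 'z::polish_space, 'y::euclidean_space, 'u::euclidean_space) team \<Rightarrow> problem
     \<Rightarrow> ('y, 'u) policy \<Rightarrow> bool" where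
  "stationary T p \<gamma> \<longleftrightarrow>
     \<gamma> \<in> policies T p \<and>
     (\<forall>i\<in>dms T. \<exists>\<kappa>.
        regular_cond_distr (zeta_law T) (info_space T p i) (closed_info T p \<gamma> i) \<kappa> \<and>
        (AE z in zeta_law T.
           zero_gradient (act_euclid T i) (act_set T i)
             (\<lambda>u. \<integral>\<^sup>+ z'. closed_cost T p (\<gamma>(i := (\<lambda>_. u))) z' \<partial>\<kappa> (closed_info T p \<gamma> i z))
             (\<gamma> i (closed_info T p \<gamma> i z))))"

text \<open>
  The static measurements with control-sharing reduction.  The exceptional null set does not depend
  on $u^{\downarrow i}$: otherwise the relation would say nothing about the realized actions, which
  are themselves random.
\<close>

definition cs_related ::
  "('w, 'z::polish_space, 'y, 'u) team \<Rightarrow> ('y, 'u) policy \<Rightarrow> ('y, 'u) policy \<Rightarrow> bool" where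
  "cs_related T \<gamma>DCS \<gamma>CS \<longleftrightarrow>
     (\<forall>i\<in>dms T. AE z in zeta_law T. \<forall>u\<in>PiE (down T i) (act_set T).
        \<gamma>DCS i (info T PDCS i z u) = \<gamma>CS i (info T PCS i z u))"

text \<open>The DMs' actions agree almost surely, each policy being played in its own problem.\<close>

definition same_actions ::
  "('w, 'z::polish_space, 'y, 'u) team \<Rightarrow> problem \<Rightarrow> ('y, 'u) policy \<Rightarrow> problem \<Rightarrow> ('y, 'u) policy
     \<Rightarrow> bool" where
  "same_actions T p \<gamma> q \<delta> \<longleftrightarrow>
     (\<forall>i\<in>dms T. AE z in zeta_law T.
        \<gamma> i (closed_info T p \<gamma> i z) = \<delta> i (closed_info T q \<delta> i z))"

definition pn_team ::
  "('w, 'z::polish_space, 'y::euclidean_space, 'u::euclidean_space) team \<Rightarrow> bool" where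
  "pn_team T \<longleftrightarrow> is_team T \<and> (\<forall>p. partially_nested T p)"

end

theory Submission
  imports Defs
begin

text \<open>
  Since the decision makers act in turn, the play of a policy is the only solution of the equations
  \<open>u i = \<gamma> i (info T p i z u)\<close>, so two problems have the same play as soon as these equations agree
  along one of them.  Stationarity moves with the play because a regular conditional distribution
  given \<open>Y\<close> is one given \<open>Y'\<close> whenever \<open>Y\<close> and \<open>Y'\<close> are almost surely Borel functions of each
  other.

  For (i), the dynamic information is a Borel function of the static information.  The converse holds
  almost surely along any fixed play: the inverses of the $g_i$ are defined on analytic sets only, but
  inner regularity of the law of the graph makes them Borel outside a null set.  For (ii) and (iii),
  partial nestedness lets a DM recompute the shared actions from its observations, so a deviation
  that uses them has the effect of one that does not.

  In the counterexamples sharing controls allows a threat: DM 2 makes every deviation of DM 1 useless,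
  and this threat disappears when DM 2 plays a constant that agrees with it on the realized play.
\<close>

section \<open>Almost sure factorization\<close>

text \<open>The image of a Borel set is only analytic, and \<open>\<Psi>\<close> need not be
  continuous. So compact sets are taken inside the graph of \<open>\<Psi>\<close> over
  \<open>B\<close>: their projections are compact subsets of the image, and by inner regularity
  countably many of them contain \<open>\<Psi> x\<close> for almost every \<open>x\<close> in
  \<open>B\<close>.\<close>

lemma sigma_compact_image:
  fixes M :: "'a::{second_countable_topology, complete_space} measure"
    and \<Psi> :: "'a \<Rightarrow> 'b::{second_countable_topology, complete_space}"
  assumes "finite_measure M" and sets_M: "sets M = sets borel"
    and \<Psi>: "\<Psi> \<in> borel_measurable borel" and B: "B \<in> sets borel"
  obtains D where "D \<in> sets borel" "D \<subseteq> \<Psi> ` B" "B - \<Psi> -` D \<in> null_sets M"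
proof -
  interpret finite_measure M by fact
  note [measurable] = B \<Psi>
  have [measurable_cong]: "sets M = sets borel" by (fact sets_M)
  have space_M: "space M = UNIV" using sets_eq_imp_space_eq[OF sets_M] by simp
  let ?p = "\<lambda>x. (x, \<Psi> x)"
  define N where "N = distr M borel ?p"
  have p [measurable]: "?p \<in> M \<rightarrow>\<^sub>M borel"
    by measurable
  interpret N: finite_measure N
    unfolding N_def by (rule finite_measure_distr) measurable
  let ?G = "{q. fst q \<in> B \<and> snd q = \<Psi> (fst q)}"
  \<comment> \<open>The graph is the pullback of the closed diagonal under
    \<open>(x, y) \<mapsto> (y, \<Psi> x)\<close>, cut down to the strip over
    \<open>B\<close>.\<close>
  have G: "?G \<in> sets borel"
  proof -
    have "closed {q :: 'b \<times> 'b. fst q = snd q}"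
      by (intro closed_Collect_eq continuous_intros)
    then have "{q :: 'b \<times> 'b. fst q = snd q} \<in> sets borel"
      by simp
    moreover have "(\<lambda>q :: 'a \<times> 'b. (snd q, \<Psi> (fst q))) \<in> borel_measurable borel"
      by (simp add: borel_prod[symmetric])
    ultimately have "(\<lambda>q. (snd q, \<Psi> (fst q))) -` {q. fst q = snd q} \<inter> space borel \<in> sets (borel :: ('a \<times> 'b) measure)"
      by (rule measurable_sets[rotated])
    moreover have "{q :: 'a \<times> 'b. fst q \<in> B} \<in> sets borel"
      using measurable_sets[OF borel_measurable_continuous_onI[OF continuous_on_fst[OF continuous_on_id]] B]
      by (simp add: vimage_def)
    ultimately have "(\<lambda>q. (snd q, \<Psi> (fst q))) -` {q. fst q = snd q} \<inter> space borel
        \<inter> {q :: 'a \<times> 'b. fst q \<in> B} \<in> sets borel"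
      by (rule sets.Int)
    also have "(\<lambda>q. (snd q, \<Psi> (fst q))) -` {q. fst q = snd q} \<inter> space borel
        \<inter> {q :: 'a \<times> 'b. fst q \<in> B} = ?G" by auto
    finally show ?thesis .
  qed
  have "\<exists>K. K \<subseteq> ?G \<and> compact K \<and> emeasure N ?G \<le> emeasure N K + ennreal (1 / Suc n)" for n :: nat
  proof -
    have "emeasure N ?G = (SUP K\<in>{K. K \<subseteq> ?G \<and> compact K}. emeasure N K)"
      by (rule inner_regular[OF _ _ G]) (simp_all add: N_def[THEN arg_cong[of _ _ sets]])
    then have "\<exists>K\<in>{K. K \<subseteq> ?G \<and> compact K}. emeasure N ?G < emeasure N K + ennreal (1 / Suc n)"
      by (rule SUP_approx_ennreal[rotated 2]) (auto simp: N.emeasure_eq_measure)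
    then show ?thesis
      by (auto intro: less_imp_le)
  qed
  then obtain K where "\<forall>n::nat. K n \<subseteq> ?G \<and> compact (K n) \<and>
      emeasure N ?G \<le> emeasure N (K n) + ennreal (1 / Suc n)"
    by (rule choice[OF allI, THEN exE])
  then have K: "K n \<subseteq> ?G" "compact (K n)"
    "emeasure N ?G \<le> emeasure N (K n) + ennreal (1 / Suc n)" for n :: nat
    by auto
  define D where "D = (\<Union>n. snd ` K n)"
  have "compact (snd ` K n)" for n
    by (intro compact_continuous_image continuous_intros K)
  then have D [measurable]: "D \<in> sets borel"
    unfolding D_def by (intro sets.countable_UN borel_compact image_subsetI)
  have D_sub: "D \<subseteq> \<Psi> ` B"
  proof
    fix y assume "y \<in> D"
    then obtain n x where "(x, y) \<in> K n"
      unfolding D_def by auto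
    with K(1)[of n] show "y \<in> \<Psi> ` B"
      by auto
  qed
  have E: "B - \<Psi> -` D \<in> sets M"
    unfolding sets_M using measurable_sets[OF \<Psi> D] by auto
  have "emeasure M (B - \<Psi> -` D) \<le> ennreal (1 / Suc n)" for n
  proof -
    have Kb: "K n \<in> sets borel" using K(2) by (simp add: borel_compact)
    have "B - \<Psi> -` D \<subseteq> B - ?p -` K n"
      unfolding D_def by force
    then have "emeasure M (B - \<Psi> -` D) \<le> emeasure M (B - ?p -` K n)"
    proof (rule emeasure_mono)
      have "?p -` K n \<inter> space M \<in> sets M"
        by (rule measurable_sets[OF p Kb])
      then have "B - ?p -` K n \<inter> space M \<in> sets M"
        using B sets_M by blast
      then show "B - ?p -` K n \<in> sets M"
        by (simp add: space_M)
    qed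
    also have "B - ?p -` K n = ?p -` (?G - K n) \<inter> space M"
      by (auto simp: space_M)
    also have "emeasure M \<dots> = emeasure N (?G - K n)"
      unfolding N_def by (rule emeasure_distr[OF p, symmetric]) (intro sets.Diff G Kb)
    also have "\<dots> = emeasure N ?G - emeasure N (K n)"
      by (rule emeasure_Diff) (use G Kb K(1) in \<open>simp_all add: N_def[THEN arg_cong[of _ _ sets]]\<close>)
    also have "\<dots> \<le> ennreal (1 / Suc n)"
      using K(3)[of n] by (simp add: ennreal_minus_le_iff add.commute)
    finally show ?thesis .
  qed
  note small = this
  have "emeasure M (B - \<Psi> -` D) \<le> 0"
  proof (rule ennreal_le_epsilon)
    fix \<epsilon> :: real assume "0 < \<epsilon>"
    then obtain n where "1 / Suc n < \<epsilon>"
      using nat_approx_posE by blast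
    then show "emeasure M (B - \<Psi> -` D) \<le> 0 + ennreal \<epsilon>"
      using order_trans[OF small[of n] ennreal_leI[of "1 / Suc n" \<epsilon>]] by simp
  qed
  then show thesis
    using that[OF D D_sub] E by auto
qed

text \<open>By \<open>det\<close>, the value of \<open>\<Phi>\<close> at any preimage under
  \<open>\<Psi>\<close> defines \<open>F\<close> on the image. This \<open>F\<close> is measurable
  for the completed law of \<open>\<Psi>\<close>, and a function measurable for a completion equals
  a Borel one almost everywhere.\<close>

lemma real_factorization_AE:
  fixes M :: "'a::{second_countable_topology, complete_space} measure"
    and \<Psi> :: "'a \<Rightarrow> 'b::{second_countable_topology, complete_space}" and \<Phi> :: "'a \<Rightarrow> real"
  assumes fin: "finite_measure M" and sets_M: "sets M = sets borel"
    and \<Psi>: "\<Psi> \<in> borel_measurable borel" and \<Phi>: "\<Phi> \<in> borel_measurable borel"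
    and det: "\<And>x x'. \<Psi> x = \<Psi> x' \<Longrightarrow> \<Phi> x = \<Phi> x'"
  shows "\<exists>F \<in> borel_measurable borel. AE x in M. F (\<Psi> x) = \<Phi> x"
proof -
  note [measurable] = \<Psi> \<Phi>
  have [measurable_cong]: "sets M = sets borel" by (fact sets_M)
  have space_M: "space M = UNIV" using sets_eq_imp_space_eq[OF sets_M] by simp
  define N where "N = distr M borel \<Psi>"
  define F where "F y = \<Phi> (inv \<Psi> y)" for y
  have F: "F (\<Psi> x) = \<Phi> x" for x
    unfolding F_def by (rule det) (simp add: f_inv_into_f)
  have "F \<in> borel_measurable (completion N)"
  proof (rule measurableI)
    fix C :: "real set" assume C [measurable]: "C \<in> sets borel"
    let ?B = "\<Phi> -` C" and ?B' = "\<Phi> -` (- C)"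
    have B: "?B \<in> sets borel" "?B' \<in> sets borel"
      using measurable_sets[OF \<Phi>, of C] measurable_sets[OF \<Phi>, of "- C"] by auto
    \<comment> \<open>On \<open>D\<close> the function \<open>F\<close> lies in \<open>C\<close>, on
      \<open>D'\<close> it avoids \<open>C\<close>, and what neither set catches is null under the
      law of \<open>\<Psi>\<close>. So the preimage of \<open>C\<close> is \<open>D\<close> up to a
      null set. Points off the image of \<open>\<Psi>\<close> fall into that null remainder, which
      makes the arbitrary values of \<open>inv\<close> there harmless.\<close>
    obtain D where D: "D \<in> sets borel" "D \<subseteq> \<Psi> ` ?B" "?B - \<Psi> -` D \<in> null_sets M"
      using sigma_compact_image[OF fin sets_M \<Psi> B(1)] .
    obtain D' where D': "D' \<in> sets borel" "D' \<subseteq> \<Psi> ` ?B'" "?B' - \<Psi> -` D' \<in> null_sets M"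
      using sigma_compact_image[OF fin sets_M \<Psi> B(2)] .
    have "\<Psi> -` (- (D \<union> D')) \<inter> space M \<in> sets M"
      using D(1) D'(1) by (intro measurable_sets[of \<Psi> M borel]) auto
    then have "\<Psi> -` (- (D \<union> D')) \<inter> space M \<in> null_sets M"
      by (rule null_sets_subset[OF null_sets.Un[OF D(3) D'(3)]]) auto
    then have "- (D \<union> D') \<in> null_sets N"
      unfolding N_def using D(1) D'(1) by (subst null_sets_distr_iff) auto
    then have "F -` C - D \<in> sets (completion N)"
      by (rule null_sets_completion) (use D' F in auto)
    moreover have "D \<in> sets (completion N)"
      using D(1) by (intro sets_completionI_sets) (simp add: N_def)
    ultimately have "(F -` C - D) \<union> D \<in> sets (completion N)"
      by (rule sets.Un)
    also have "(F -` C - D) \<union> D = F -` C \<inter> space (completion N)"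
      using D(2) F by (auto simp: N_def)
    finally show "F -` C \<inter> space (completion N) \<in> sets (completion N)" .
  qed simp
  from completion_ex_borel_measurable_real[OF this]
  obtain F' where F': "F' \<in> borel_measurable N" "AE y in N. F y = F' y" by blast
  from F'(2) have "AE x in M. F (\<Psi> x) = F' (\<Psi> x)"
    unfolding N_def by (rule AE_distrD[rotated]) simp
  then have "AE x in M. F' (\<Psi> x) = \<Phi> x"
    by (simp add: F eq_commute)
  moreover have "F' \<in> borel_measurable borel"
    using F'(1) by (simp add: N_def)
  ultimately show ?thesis
    by blast
qed

text \<open>\<open>e\<close> and \<open>r\<close> exhibit the space of \<open>M\<close> as a
  measurable retract of a Polish type, so the real case applies to the law of \<open>e\<close>;
  composing with \<open>r\<close> makes \<open>det\<close> available at all points. Vector values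
  are treated coordinatewise.\<close>

lemma factorization_AE:
  fixes M :: "'a measure" and e :: "'a \<Rightarrow> 'p::{second_countable_topology, complete_space}"
    and \<Psi> :: "'a \<Rightarrow> 'b::{second_countable_topology, complete_space}"
    and \<Phi> :: "'a \<Rightarrow> 'c::euclidean_space"
  assumes fin: "finite_measure M"
    and e: "e \<in> borel_measurable M" and r: "r \<in> borel \<rightarrow>\<^sub>M M"
    and inverse: "\<And>x. x \<in> space M \<Longrightarrow> r (e x) = x"
    and \<Psi>: "\<Psi> \<in> borel_measurable M" and \<Phi>: "\<Phi> \<in> borel_measurable M"
    and det: "\<And>x x'. x \<in> space M \<Longrightarrow> x' \<in> space M \<Longrightarrow> \<Psi> x = \<Psi> x' \<Longrightarrow> \<Phi> x = \<Phi> x'"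
  shows "\<exists>F \<in> borel_measurable borel. AE x in M. F (\<Psi> x) = \<Phi> x"
proof -
  note [measurable] = e r \<Psi> \<Phi>
  let ?M = "distr M borel e"
  have rM: "r x \<in> space M" for x
    using measurable_space[OF r] by simp
  have "\<exists>F \<in> borel_measurable borel. AE x in ?M. F (\<Psi> (r x)) = \<Phi> (r x) \<bullet> b" for b
  proof (rule real_factorization_AE)
    show "finite_measure ?M"
      by (rule finite_measure.finite_measure_distr[OF fin e])
    show "\<Phi> (r x) \<bullet> b = \<Phi> (r x') \<bullet> b" if "\<Psi> (r x) = \<Psi> (r x')" for x x'
      by (metis that det rM)
    show "(\<lambda>x. \<Psi> (r x)) \<in> borel_measurable borel" "(\<lambda>x. \<Phi> (r x) \<bullet> b) \<in> borel_measurable borel"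
      by measurable
  qed simp
  moreover have "AE x in M. F (\<Psi> x) = \<Phi> x \<bullet> b" if "AE x in ?M. F (\<Psi> (r x)) = \<Phi> (r x) \<bullet> b" for F b
    using AE_distrD[OF e that] by (rule AE_mp) (auto simp: inverse)
  ultimately have "\<exists>F \<in> borel_measurable borel. AE x in M. F (\<Psi> x) = \<Phi> x \<bullet> b" for b
    by blast
  then obtain F where F: "\<And>b. F b \<in> borel_measurable borel" "\<And>b. AE x in M. F b (\<Psi> x) = \<Phi> x \<bullet> b"
    by metis
  have "AE x in M. \<forall>b\<in>Basis. F b (\<Psi> x) = \<Phi> x \<bullet> b"
    using F(2) by (intro AE_finite_allI) auto
  then have "AE x in M. (\<Sum>b\<in>Basis. F b (\<Psi> x) *\<^sub>R b) = \<Phi> x"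
    by eventually_elim (simp add: euclidean_representation)
  moreover have "(\<lambda>y. \<Sum>b\<in>Basis. F b y *\<^sub>R b) \<in> borel_measurable borel"
    using F(1) by measurable
  ultimately show ?thesis
    by (rule bexI[where x = "\<lambda>y. \<Sum>b\<in>Basis. F b y *\<^sub>R b"])
qed

section \<open>Plays of a nested team\<close>

locale nested_team =
  fixes T :: "('w, 'z::polish_space, 'y::euclidean_space, 'u::euclidean_space) team"
  assumes pn_team: "pn_team T"
begin

lemma is_team: "is_team T" and nested: "partially_nested T p"
  using pn_team by (auto simp: pn_team_def)

lemma down_subset: "i \<in> dms T \<Longrightarrow> down T i \<subseteq> {1..<i}"
  using is_team by (auto simp: is_team_def)

lemma down_subset_dms: "i \<in> dms T \<Longrightarrow> down T i \<subseteq> dms T"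
  using down_subset by fastforce

text \<open>Under control sharing the shared actions are themselves information, so nestedness of
  \<open>PCS\<close> hands DM \<open>i\<close> also the actions that DM \<open>k\<close> was
  shown.\<close>

lemma down_trans:
  assumes "i \<in> dms T" "k \<in> down T i"
  shows "down T k \<subseteq> down T i" "obs_idx T k \<subseteq> obs_idx T i"
proof -
  have "k \<in> affecting T PCS i"
    using assms by (simp add: affecting_def shared_idx_def dynamic_def control_sharing_def)
  then show "down T k \<subseteq> down T i" "obs_idx T k \<subseteq> obs_idx T i"
    using nested[of PCS] assms(1)
    by (auto simp: partially_nested_def shared_idx_def control_sharing_def)
qed

text \<open>Transitivity of \<open>down\<close> collapses the closure in \<open>obs_idx\<close> to
  at most one step.\<close>

lemma obs_idx_eq:
  assumes i: "i \<in> dms T"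
  shows "obs_idx T i = insert i (down T i)"
proof
  show "obs_idx T i \<subseteq> insert i (down T i)"
  proof
    fix j assume "j \<in> obs_idx T i"
    then have "(i, j) \<in> {(a, b). b \<in> down T a}\<^sup>*"
      by (simp add: obs_idx_def)
    then show "j \<in> insert i (down T i)"
      by (induction rule: rtrancl_induct) (use down_trans(1)[OF i] in auto)
  qed
  show "insert i (down T i) \<subseteq> obs_idx T i"
    by (auto simp: obs_idx_def)
qed

lemma obs_idx_subset_dms: "i \<in> dms T \<Longrightarrow> obs_idx T i \<subseteq> dms T"
  using obs_idx_eq down_subset_dms by auto

lemma down_obs_idx: "i \<in> dms T \<Longrightarrow> j \<in> obs_idx T i \<Longrightarrow> down T j \<subseteq> down T i"
  by (metis insertE obs_idx_eq down_trans(1) order_refl)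

lemma shared_idx_subset: "shared_idx T p i \<subseteq> down T i"
  by (simp add: shared_idx_def)

lemma obs_cong:
  assumes "\<And>k. k \<in> down T j \<Longrightarrow> u k = v k"
  shows "obs T p j z u = obs T p j z v"
  using assms by (auto simp: obs_def intro!: arg_cong[of _ _ "dyn_obs T j (stat_obs T j z)"])

text \<open>Each observation held by DM \<open>i\<close> reacts only to a set
  \<open>down T j\<close> inside \<open>down T i\<close>, and the shared controls have their indices
  in \<open>down T i\<close> as well.\<close>

lemma info_cong:
  assumes i: "i \<in> dms T" and eq: "\<And>k. k \<in> down T i \<Longrightarrow> u k = v k"
  shows "info T p i z u = info T p i z v"
proof -
  have "obs T p j z u = obs T p j z v" if "j \<in> obs_idx T i" for j
    by (rule obs_cong) (use eq down_obs_idx[OF i that] in blast)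
  then show ?thesis
    using eq shared_idx_subset by (auto simp: info_def fun_eq_iff restrict_def subset_iff)
qed

lemma actions_stable: "k \<le> n \<Longrightarrow> j \<le> k \<Longrightarrow> actions T p \<gamma> z n j = actions T p \<gamma> z k j"
  by (induction n) (auto simp: le_Suc_eq)

text \<open>The recursion feeds DM \<open>i\<close> with the actions of its predecessors only,
  whereas the right-hand side uses the complete play. The two profiles agree on
  \<open>down T i\<close>, which contains only earlier DMs.\<close>

lemma play_eq:
  assumes i: "i \<in> dms T"
  shows "play T p \<gamma> z i = \<gamma> i (info T p i z (play T p \<gamma> z))"
proof -
  obtain k where k: "i = Suc k" using i by (cases i) auto
  have "play T p \<gamma> z i = actions T p \<gamma> z i i"
    unfolding play_def using i by (intro actions_stable) auto
  also have "\<dots> = \<gamma> i (info T p i z (actions T p \<gamma> z k))"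
    by (simp add: k)
  also have "info T p i z (actions T p \<gamma> z k) = info T p i z (play T p \<gamma> z)"
    unfolding play_def
    by (intro info_cong[OF i] actions_stable[symmetric]) (use i k down_subset[OF i] in auto)
  finally show ?thesis .
qed

lemma play_extensional: "play T p \<gamma> z \<in> extensional (dms T)"
proof -
  have "actions T p \<gamma> z n \<in> extensional {1..n}" for n
    by (induction n) (auto simp: extensional_def)
  then show ?thesis
    by (simp add: play_def)
qed

text \<open>Strong induction along the order of play: the equation at \<open>i\<close> refers only
  to actions of earlier DMs. Extensionality settles the values outside \<open>dms T\<close>.\<close>

lemma play_unique:
  assumes ext: "u \<in> extensional (dms T)"
    and eq: "\<And>i. i \<in> dms T \<Longrightarrow> u i = \<gamma> i (info T p i z u)"
  shows "play T p \<gamma> z = u"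
proof (rule extensionalityI[OF play_extensional ext])
  fix i assume "i \<in> dms T"
  then show "play T p \<gamma> z i = u i"
  proof (induction i rule: less_induct)
    case (less i)
    have "info T p i z (play T p \<gamma> z) = info T p i z u"
      by (rule info_cong[OF less.prems], rule less.IH)
        (use less.prems down_subset[OF less.prems] in auto)
    then show ?case
      using eq[OF less.prems] play_eq[OF less.prems, of p \<gamma> z] by simp
  qed
qed

lemma play_eqI:
  assumes "\<And>i. i \<in> dms T \<Longrightarrow>
    \<gamma> i (info T p i z (play T q \<delta> z)) = \<delta> i (info T q i z (play T q \<delta> z))"
  shows "play T p \<gamma> z = play T q \<delta> z"
  by (rule play_unique[OF play_extensional]) (simp add: assms play_eq)

section \<open>Measurability of observations, information and plays\<close>

lemma stat_obs_measurable: "i \<in> dms T \<Longrightarrow> stat_obs T i \<in> zeta_space T \<rightarrow>\<^sub>M stat_obs_space T i"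
  using is_team by (simp add: is_team_def)

lemma dyn_obs_measurable:
  assumes "i \<in> dms T" "f \<in> M \<rightarrow>\<^sub>M stat_obs_space T i" "U \<in> M \<rightarrow>\<^sub>M PiM K (act_space T)"
    "down T i \<subseteq> K"
  shows "(\<lambda>x. dyn_obs T i (f x) (restrict (U x) (down T i))) \<in> M \<rightarrow>\<^sub>M dyn_obs_space T i"
proof -
  have "(\<lambda>(s, u). dyn_obs T i s u)
      \<in> stat_obs_space T i \<Otimes>\<^sub>M PiM (down T i) (act_space T) \<rightarrow>\<^sub>M dyn_obs_space T i"
    using is_team assms(1) by (simp add: is_team_def)
  moreover have "(\<lambda>x. (f x, restrict (U x) (down T i)))
      \<in> M \<rightarrow>\<^sub>M stat_obs_space T i \<Otimes>\<^sub>M PiM (down T i) (act_space T)"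
    by (intro measurable_Pair assms measurable_compose[OF assms(3) measurable_restrict_subset])
  ultimately show ?thesis
    using measurable_compose by fastforce
qed

lemma info_measurable:
  assumes i: "i \<in> dms T" and f: "f \<in> M \<rightarrow>\<^sub>M zeta_space T"
    and U: "U \<in> M \<rightarrow>\<^sub>M PiM K (act_space T)" and K: "down T i \<subseteq> K"
  shows "(\<lambda>x. info T p i (f x) (U x)) \<in> M \<rightarrow>\<^sub>M info_space T p i"
  unfolding info_def info_space_def
proof (rule measurable_Pair, rule measurable_restrict)
  fix j assume j: "j \<in> obs_idx T i"
  then have dms: "j \<in> dms T" and sub: "down T j \<subseteq> K"
    using obs_idx_subset_dms[OF i] down_obs_idx[OF i] K by auto
  show "(\<lambda>x. obs T p j (f x) (U x)) \<in> M \<rightarrow>\<^sub>M obs_space T p j"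
    using dyn_obs_measurable[OF dms measurable_compose[OF f stat_obs_measurable[OF dms]] U sub]
      measurable_compose[OF f stat_obs_measurable[OF dms]]
    by (simp add: obs_def obs_space_def)
next
  show "(\<lambda>x. restrict (U x) (shared_idx T p i)) \<in> M \<rightarrow>\<^sub>M PiM (shared_idx T p i) (act_space T)"
    by (rule measurable_compose[OF U measurable_restrict_subset]) (use shared_idx_subset K in blast)
qed

lemma policies_update:
  "\<gamma> \<in> policies T p \<Longrightarrow> \<beta> \<in> dm_policies T p i \<Longrightarrow> \<gamma>(i := \<beta>) \<in> policies T p"
  by (auto simp: policies_def)

lemma play_measurable:
  assumes \<gamma>: "\<gamma> \<in> policies T p"
  shows "play T p \<gamma> \<in> zeta_space T \<rightarrow>\<^sub>M PiM (dms T) (act_space T)"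
proof -
  have "(\<lambda>z. actions T p \<gamma> z n) \<in> zeta_space T \<rightarrow>\<^sub>M PiM {1..n} (act_space T)" if "n \<le> num_dms T" for n
    using that
  proof (induction n)
    case (Suc n)
    then have dm: "Suc n \<in> dms T"
      and IH: "(\<lambda>z. actions T p \<gamma> z n) \<in> zeta_space T \<rightarrow>\<^sub>M PiM {1..n} (act_space T)"
      by simp_all
    have "(\<lambda>z. info T p (Suc n) z (actions T p \<gamma> z n)) \<in> zeta_space T \<rightarrow>\<^sub>M info_space T p (Suc n)"
      by (rule info_measurable[OF dm _ IH]) (use down_subset[OF dm] in auto)
    moreover have "\<gamma> (Suc n) \<in> info_space T p (Suc n) \<rightarrow>\<^sub>M act_space T (Suc n)"
      using \<gamma> dm by (auto simp: policies_def dm_policies_def)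
    ultimately have "(\<lambda>z. \<gamma> (Suc n) (info T p (Suc n) z (actions T p \<gamma> z n)))
        \<in> zeta_space T \<rightarrow>\<^sub>M act_space T (Suc n)"
      by (rule measurable_compose)
    then show ?case
      unfolding actions.simps
      by (rule measurable_fun_upd[OF _ IH, rotated]) auto
  qed (auto simp: measurable_PiM_single')
  from this[OF order_refl] show ?thesis
    by (simp add: play_def[abs_def])
qed

lemma closed_info_measurable:
  assumes "\<gamma> \<in> policies T p" "i \<in> dms T"
  shows "closed_info T p \<gamma> i \<in> zeta_space T \<rightarrow>\<^sub>M info_space T p i"
  unfolding closed_info_def[abs_def]
  by (rule info_measurable[OF assms(2) measurable_ident_sets[OF refl] play_measurable[OF assms(1)] down_subset_dms[OF assms(2)]])

lemma play_in_PiE: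
  "\<gamma> \<in> policies T p \<Longrightarrow> z \<in> space (zeta_space T) \<Longrightarrow> play T p \<gamma> z \<in> PiE (dms T) (act_set T)"
  using measurable_space[OF play_measurable] by (fastforce simp: space_PiM act_space_def space_restrict_space)

lemma zeta_measurable: "zeta T \<in> prim_prob T \<rightarrow>\<^sub>M zeta_space T"
  unfolding zeta_def[abs_def] zeta_space_def
  using is_team by (intro measurable_restrict) (auto simp: is_team_def)

lemma prob_space_prim: "prob_space (prim_prob T)"
  using is_team by (simp add: is_team_def)

lemma prob_space_zeta_law: "prob_space (zeta_law T)"
  unfolding zeta_law_def by (rule prob_space.prob_space_distr[OF prob_space_prim zeta_measurable])

lemma sets_zeta_law: "sets (zeta_law T) = sets (zeta_space T)"
  and space_zeta_law: "space (zeta_law T) = space (zeta_space T)"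
  by (simp_all add: zeta_law_def)

lemma measurable_zeta_law: "f \<in> zeta_law T \<rightarrow>\<^sub>M N \<longleftrightarrow> f \<in> zeta_space T \<rightarrow>\<^sub>M N"
  using measurable_cong_sets[OF sets_zeta_law refl] by blast

lemma J_cong:
  assumes "AE z in zeta_law T. play T p \<gamma> z = play T q \<delta> z"
  shows "J T p \<gamma> = J T q \<delta>"
proof -
  have "AE w in prim_prob T. play T p \<gamma> (zeta T w) = play T q \<delta> (zeta T w)"
    using assms unfolding zeta_law_def by (rule AE_distrD[OF zeta_measurable])
  then show ?thesis
    unfolding J_def closed_cost_def by (intro nn_integral_cong_AE) auto
qed

end

section \<open>Transfer of optimality and stationarity\<close>

lemma finite_measure_subalgebra_vimage:
  assumes "finite_measure M" and Y: "Y \<in> M \<rightarrow>\<^sub>M N"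
  shows "finite_measure_subalgebra M (vimage_algebra (space M) Y N)"
proof -
  have "Y \<in> space M \<rightarrow> space N"
    using measurable_space[OF Y] by blast
  then have "subalgebra M (vimage_algebra (space M) Y N)"
    using measurable_sets[OF Y] by (auto simp: subalgebra_def sets_vimage_algebra2)
  then show ?thesis
    using assms(1) by (simp add: finite_measure_subalgebra_def finite_measure_subalgebra_axioms_def)
qed

text \<open>\<open>H\<close> makes the new kernel a function of \<open>Y'\<close>, and
  \<open>K\<close> turns each event of \<open>Y'\<close> into an event of \<open>Y\<close> that
  differs from it by a null set. Hence the averaging identity known for \<open>Y\<close>
  characterizes the conditional expectation given \<open>Y'\<close> too.\<close>

lemma regular_cond_distr_transfer:
  assumes "prob_space M" and Y: "Y \<in> M \<rightarrow>\<^sub>M N" and Y': "Y' \<in> M \<rightarrow>\<^sub>M N'"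
    and H: "H \<in> N' \<rightarrow>\<^sub>M N" and K: "K \<in> N \<rightarrow>\<^sub>M N'"
    and HY': "AE x in M. H (Y' x) = Y x" and KY: "AE x in M. K (Y x) = Y' x"
    and rcd: "regular_cond_distr M N Y \<kappa>"
  shows "regular_cond_distr M N' Y' (\<lambda>y. \<kappa> (H y))"
proof -
  interpret prob_space M by fact
  let ?F = "vimage_algebra (space M) Y N" and ?F' = "vimage_algebra (space M) Y' N'"
  have Y'_space: "Y' \<in> space M \<rightarrow> space N'"
    using measurable_space[OF Y'] by blast
  then have YF': "Y' \<in> ?F' \<rightarrow>\<^sub>M N'"
    by (rule measurable_vimage_algebra1)
  interpret F: finite_measure_subalgebra M ?F
    by (rule finite_measure_subalgebra_vimage[OF finite_measure_axioms Y])
  interpret F': finite_measure_subalgebra M ?F'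
    by (rule finite_measure_subalgebra_vimage[OF finite_measure_axioms Y'])
  have \<kappa>: "\<kappa> \<in> N \<rightarrow>\<^sub>M prob_algebra M"
    and cond: "\<And>B. B \<in> sets M \<Longrightarrow>
      AE x in M. emeasure (\<kappa> (Y x)) B = nn_cond_exp M ?F (indicator B) x"
    using rcd by (auto simp: regular_cond_distr_def)
  have eB: "(\<lambda>y. emeasure (\<kappa> y) B) \<in> borel_measurable N" if "B \<in> sets M" for B
    using measurable_compose[OF measurable_prob_algebraD[OF \<kappa>] measurable_emeasure_subprob_algebra[OF that]] .
  have "AE x in M. emeasure (\<kappa> (H (Y' x))) B = nn_cond_exp M ?F' (indicator B) x"
    if B [measurable]: "B \<in> sets M" for B
  proof (rule F'.nn_cond_exp_charact)
    show "(\<lambda>x. emeasure (\<kappa> (H (Y' x))) B) \<in> borel_measurable ?F'"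
      by (rule measurable_compose[OF YF' measurable_compose[OF H eB[OF B]]])
    fix A assume "A \<in> sets ?F'"
    then obtain C where C: "C \<in> sets N'" "A = Y' -` C \<inter> space M"
      unfolding sets_vimage_algebra2[OF Y'_space] by blast
    \<comment> \<open>The event of \<open>Y\<close> that matches \<open>A\<close>, because
      \<open>Y' x\<close> is almost surely \<open>K (Y x)\<close>.\<close>
    define A' where "A' = Y -` (K -` C \<inter> space N) \<inter> space M"
    have A'F [measurable]: "A' \<in> sets ?F"
      using measurable_sets[OF K C(1)] unfolding A'_def
      by (intro in_vimage_algebra)
    have AA': "AE x in M. indicator A x = (indicator A' x :: ennreal)"
      using KY AE_space
    proof eventually_elim
      case (elim x)
      then show ?case
        using measurable_space[OF Y] by (auto simp: C(2) A'_def indicator_def)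
    qed
    have "(\<integral>\<^sup>+x\<in>A. indicator B x \<partial>M) = (\<integral>\<^sup>+x. indicator A' x * indicator B x \<partial>M)"
      by (rule nn_integral_cong_AE, use AA' in eventually_elim) (simp add: mult.commute)
    also have "\<dots> = (\<integral>\<^sup>+x. indicator A' x * nn_cond_exp M ?F (indicator B) x \<partial>M)"
      by (rule F.nn_cond_exp_intg[symmetric]) auto
    also have "\<dots> = (\<integral>\<^sup>+x\<in>A. emeasure (\<kappa> (H (Y' x))) B \<partial>M)"
      by (rule nn_integral_cong_AE, use AA' HY' cond[OF B] in eventually_elim)
        (simp add: mult.commute)
    finally show "(\<integral>\<^sup>+x\<in>A. indicator B x \<partial>M) = (\<integral>\<^sup>+x\<in>A. emeasure (\<kappa> (H (Y' x))) B \<partial>M)" .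
  qed auto
  then show ?thesis
    using measurable_compose[OF H \<kappa>] by (simp add: regular_cond_distr_def)
qed

text \<open>A null set has conditional probability zero for almost every value of \<open>Y\<close>.
  This lets almost sure identities be used under the integral against
  \<open>\<kappa>\<close>.\<close>

lemma regular_cond_distr_AE:
  assumes "prob_space M" and Y: "Y \<in> M \<rightarrow>\<^sub>M N" and rcd: "regular_cond_distr M N Y \<kappa>"
    and P: "AE x in M. P x"
  shows "AE x in M. AE x' in \<kappa> (Y x). P x'"
proof -
  interpret prob_space M by fact
  let ?F = "vimage_algebra (space M) Y N"
  interpret F: finite_measure_subalgebra M ?F
    by (rule finite_measure_subalgebra_vimage[OF finite_measure_axioms Y])
  obtain B where B: "B \<in> null_sets M" "{x \<in> space M. \<not> P x} \<subseteq> B"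
    using P by (auto simp: eventually_ae_filter)
  then have [measurable]: "B \<in> sets M" by auto
  have "AE x in M. indicator B x = (0 :: ennreal)"
    using AE_not_in[OF B(1)] by eventually_elim simp
  then have "AE x in M. nn_cond_exp M ?F (indicator B) x = nn_cond_exp M ?F (\<lambda>_. 0) x"
    by (rule F.nn_cond_exp_cong) auto
  moreover have "AE x in M. 0 = nn_cond_exp M ?F (\<lambda>_. 0) x"
    by (rule F.nn_cond_exp_F_meas) auto
  moreover have "AE x in M. emeasure (\<kappa> (Y x)) B = nn_cond_exp M ?F (indicator B) x"
    using rcd by (simp add: regular_cond_distr_def)
  ultimately show ?thesis
    using AE_space
  proof eventually_elim
    case (elim x)
    then have "sets (\<kappa> (Y x)) = sets M"
      using rcd measurable_space[OF Y, of x] measurable_space[of \<kappa> N "prob_algebra M" "Y x"]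
      by (simp add: regular_cond_distr_def space_prob_algebra)
    then have "B \<in> null_sets (\<kappa> (Y x))" "{x' \<in> space (\<kappa> (Y x)). \<not> P x'} \<subseteq> B"
      using elim B sets_eq_imp_space_eq[of "\<kappa> (Y x)" M] by auto
    then show ?case
      by (rule AE_I')
  qed
qed

lemma zero_gradient_cong:
  assumes "zero_gradient E A f x" "\<And>v. v \<in> A \<Longrightarrow> f v = g v"
  shows "zero_gradient E A g x"
proof -
  obtain S where S: "openin (top_of_set E) S" "x \<in> S" "S \<subseteq> A" "\<forall>v\<in>S. f v < \<top>"
    "((\<lambda>v. enn2real (f v)) has_derivative (\<lambda>_. 0)) (at x within S)"
    using assms(1) by (auto simp: zero_gradient_def)
  have "((\<lambda>v. enn2real (g v)) has_derivative (\<lambda>_. 0)) (at x within S)"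
    by (rule has_derivative_transform[OF S(2) _ S(5)]) (use assms(2) S(3) in auto)
  then show ?thesis
    using S assms(2) by (auto simp: zero_gradient_def subset_iff intro!: exI[of _ S])
qed

context nested_team
begin

text \<open>The infimum runs over \<open>\<gamma> i\<close> as well, so it never exceeds
  \<open>J T p \<gamma>\<close> and only the lower bound has content.\<close>

lemma pbp_optimal_iff:
  "pbp_optimal T p \<gamma> \<longleftrightarrow> \<gamma> \<in> policies T p \<and>
     (\<forall>i\<in>dms T. \<forall>\<beta>\<in>dm_policies T p i. J T p \<gamma> \<le> J T p (\<gamma>(i := \<beta>)))"
proof -
  have "(J T p \<gamma> = (INF \<beta>\<in>dm_policies T p i. J T p (\<gamma>(i := \<beta>)))) \<longleftrightarrow>
      (\<forall>\<beta>\<in>dm_policies T p i. J T p \<gamma> \<le> J T p (\<gamma>(i := \<beta>)))"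
    if "\<gamma> \<in> policies T p" "i \<in> dms T" for i
  proof -
    have "\<gamma> i \<in> dm_policies T p i"
      using that by (auto simp: policies_def)
    then have "(INF \<beta>\<in>dm_policies T p i. J T p (\<gamma>(i := \<beta>))) \<le> J T p \<gamma>"
      by (rule INF_lower2) simp
    then show ?thesis
      unfolding le_INF_iff[symmetric] by (auto intro: order_antisym)
  qed
  then show ?thesis
    by (auto simp: pbp_optimal_def)
qed

lemma globally_optimal_iff:
  "globally_optimal T p \<gamma> \<longleftrightarrow> \<gamma> \<in> policies T p \<and> (\<forall>\<beta>\<in>policies T p. J T p \<gamma> \<le> J T p \<beta>)"
  unfolding globally_optimal_def le_INF_iff[symmetric] by (auto intro: order_antisym INF_lower)

text \<open>Only deviations in the target problem need a counterpart: one that lowered the cost of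
  \<open>\<delta>\<close> would have a counterpart lowering that of \<open>\<gamma>\<close>.\<close>

lemma pbp_optimal_transfer:
  assumes "pbp_optimal T p \<gamma>" "\<delta> \<in> policies T q" "J T p \<gamma> = J T q \<delta>"
    and "\<And>i \<beta>. i \<in> dms T \<Longrightarrow> \<beta> \<in> dm_policies T q i \<Longrightarrow>
      \<exists>\<beta>'\<in>dm_policies T p i. J T p (\<gamma>(i := \<beta>')) = J T q (\<delta>(i := \<beta>))"
  shows "pbp_optimal T q \<delta>"
  using assms unfolding pbp_optimal_iff by metis

lemma globally_optimal_transfer:
  assumes "globally_optimal T p \<gamma>" "\<delta> \<in> policies T q" "J T p \<gamma> = J T q \<delta>"
    and "\<And>\<beta>. \<beta> \<in> policies T q \<Longrightarrow> \<exists>\<beta>'\<in>policies T p. J T p \<beta>' = J T q \<beta>"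
  shows "globally_optimal T q \<delta>"
  using assms unfolding globally_optimal_iff by metis

text \<open>The kernel for \<open>q\<close> is the one for \<open>p\<close> read through
  \<open>H\<close>. The plays under constant deviations agree off one null set common to all
  \<open>v\<close>, because the gradient compares uncountably many of them.\<close>

lemma stationary_transfer:
  assumes stat: "stationary T p \<gamma>" and \<delta>: "\<delta> \<in> policies T q"
    and play: "AE z in zeta_law T. play T p \<gamma> z = play T q \<delta> z"
    and const: "\<And>i. i \<in> dms T \<Longrightarrow> AE z in zeta_law T. \<forall>v\<in>act_set T i.
      play T p (\<gamma>(i := \<lambda>_. v)) z = play T q (\<delta>(i := \<lambda>_. v)) z"
    and H: "\<And>i. i \<in> dms T \<Longrightarrow> \<exists>H\<in>info_space T q i \<rightarrow>\<^sub>M info_space T p i.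
      AE z in zeta_law T. H (closed_info T q \<delta> i z) = closed_info T p \<gamma> i z"
    and K: "\<And>i. i \<in> dms T \<Longrightarrow> \<exists>K\<in>info_space T p i \<rightarrow>\<^sub>M info_space T q i.
      AE z in zeta_law T. K (closed_info T p \<gamma> i z) = closed_info T q \<delta> i z"
  shows "stationary T q \<delta>"
  unfolding stationary_def
proof (intro conjI ballI \<delta>)
  fix i assume i: "i \<in> dms T"
  have \<gamma>: "\<gamma> \<in> policies T p"
    using stat by (simp add: stationary_def)
  obtain \<kappa> where \<kappa>: "regular_cond_distr (zeta_law T) (info_space T p i) (closed_info T p \<gamma> i) \<kappa>"
    and grad: "AE z in zeta_law T. zero_gradient (act_euclid T i) (act_set T i)
      (\<lambda>u. \<integral>\<^sup>+ z'. closed_cost T p (\<gamma>(i := (\<lambda>_. u))) z' \<partial>\<kappa> (closed_info T p \<gamma> i z))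
      (\<gamma> i (closed_info T p \<gamma> i z))"
    using stat i unfolding stationary_def by blast
  obtain H where H: "H \<in> info_space T q i \<rightarrow>\<^sub>M info_space T p i"
    "AE z in zeta_law T. H (closed_info T q \<delta> i z) = closed_info T p \<gamma> i z"
    using H[OF i] by blast
  obtain K where K: "K \<in> info_space T p i \<rightarrow>\<^sub>M info_space T q i"
    "AE z in zeta_law T. K (closed_info T p \<gamma> i z) = closed_info T q \<delta> i z"
    using K[OF i] by blast
  have meas: "closed_info T p \<gamma> i \<in> zeta_law T \<rightarrow>\<^sub>M info_space T p i"
    "closed_info T q \<delta> i \<in> zeta_law T \<rightarrow>\<^sub>M info_space T q i"
    using closed_info_measurable[OF \<gamma> i] closed_info_measurable[OF \<delta> i]
    by (simp_all add: measurable_zeta_law)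
  show "\<exists>\<kappa>. regular_cond_distr (zeta_law T) (info_space T q i) (closed_info T q \<delta> i) \<kappa> \<and>
      (AE z in zeta_law T. zero_gradient (act_euclid T i) (act_set T i)
         (\<lambda>u. \<integral>\<^sup>+ z'. closed_cost T q (\<delta>(i := (\<lambda>_. u))) z' \<partial>\<kappa> (closed_info T q \<delta> i z))
         (\<delta> i (closed_info T q \<delta> i z)))"
  proof (intro exI conjI)
    show "regular_cond_distr (zeta_law T) (info_space T q i) (closed_info T q \<delta> i) (\<lambda>y. \<kappa> (H y))"
      by (rule regular_cond_distr_transfer[OF prob_space_zeta_law meas H(1) K(1) H(2) K(2) \<kappa>])
    \<comment> \<open>The agreement under constant deviations is known for the law of zeta; the
      integrals to be compared are taken under the conditional law.\<close>
    have "AE z in zeta_law T. AE z' in \<kappa> (closed_info T p \<gamma> i z). \<forall>v\<in>act_set T i.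
        play T p (\<gamma>(i := \<lambda>_. v)) z' = play T q (\<delta>(i := \<lambda>_. v)) z'"
      by (rule regular_cond_distr_AE[OF prob_space_zeta_law meas(1) \<kappa> const[OF i]])
    with grad play H(2)
    show "AE z in zeta_law T. zero_gradient (act_euclid T i) (act_set T i)
         (\<lambda>u. \<integral>\<^sup>+ z'. closed_cost T q (\<delta>(i := (\<lambda>_. u))) z' \<partial>\<kappa> (H (closed_info T q \<delta> i z)))
         (\<delta> i (closed_info T q \<delta> i z))"
    proof eventually_elim
      case (elim z)
      have "\<gamma> i (closed_info T p \<gamma> i z) = \<delta> i (closed_info T q \<delta> i z)"
        using elim(2) play_eq[OF i, of p \<gamma> z] play_eq[OF i, of q \<delta> z]
        by (simp add: closed_info_def)
      moreover have "(\<integral>\<^sup>+ z'. closed_cost T p (\<gamma>(i := (\<lambda>_. v))) z' \<partial>\<kappa> (closed_info T p \<gamma> i z)) =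
          (\<integral>\<^sup>+ z'. closed_cost T q (\<delta>(i := (\<lambda>_. v))) z' \<partial>\<kappa> (H (closed_info T q \<delta> i z)))"
        if "v \<in> act_set T i" for v
        unfolding elim(3)
        by (rule nn_integral_cong_AE, use elim(4) in eventually_elim)
          (use that in \<open>simp add: closed_cost_def\<close>)
      ultimately show ?case
        using zero_gradient_cong[OF elim(1)] by simp
    qed
  qed
qed

end

section \<open>Static and dynamic measurements with control sharing\<close>

text \<open>Passage from the product spaces of the model to the Borel sets of the full function
  type, where \<open>factorization_AE\<close> works. Coordinates outside \<open>I\<close> are
  constant.\<close>

lemma PiM_restrict_space_borel:
  "(\<lambda>x. x) \<in> PiM I (\<lambda>i :: 'i::countable. restrict_space borel (S i))
     \<rightarrow>\<^sub>M (borel :: ('i \<Rightarrow> 'a::second_countable_topology) measure)"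
proof (rule measurable_coordinatewise_then_product)
  fix i
  let ?M = "PiM I (\<lambda>i. restrict_space (borel :: 'a measure) (S i))"
  show "(\<lambda>x. x i) \<in> ?M \<rightarrow>\<^sub>M borel"
  proof (cases "i \<in> I")
    case True
    have "(\<lambda>x. x i) \<in> ?M \<rightarrow>\<^sub>M restrict_space borel (S i)"
      using True by (rule measurable_component_singleton)
    then show ?thesis
      unfolding measurable_restrict_space2_iff by blast
  next
    case False
    have "x i = undefined" if "x \<in> space ?M" for x
      using that False unfolding space_PiM by (rule PiE_arb)
    then show ?thesis
      using measurable_cong[of ?M "\<lambda>x. x i" "\<lambda>_. undefined" borel] measurable_const by auto
  qed
qed

context nested_team
begin

lemma zeta_space_borel: "(\<lambda>z. z) \<in> zeta_space T \<rightarrow>\<^sub>M borel"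
  unfolding zeta_space_def prim_space_def[abs_def] by (rule PiM_restrict_space_borel)

lemma info_space_borel: "(\<lambda>y. y) \<in> info_space T p i \<rightarrow>\<^sub>M borel"
proof -
  have obs: "(\<lambda>x. x) \<in> PiM (obs_idx T i) (obs_space T p) \<rightarrow>\<^sub>M borel"
    unfolding obs_space_def dyn_obs_space_def[abs_def] stat_obs_space_def[abs_def]
    by (cases "dynamic p") (simp_all only: if_True if_False PiM_restrict_space_borel)
  have act: "(\<lambda>x. x) \<in> PiM (shared_idx T p i) (act_space T) \<rightarrow>\<^sub>M borel"
    unfolding act_space_def[abs_def] by (rule PiM_restrict_space_borel)
  have "(\<lambda>y. (fst y, snd y)) \<in> info_space T p i \<rightarrow>\<^sub>M borel \<Otimes>\<^sub>M borel"
    unfolding info_space_def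
    by (intro measurable_Pair measurable_compose[OF measurable_fst obs]
        measurable_compose[OF measurable_snd act])
  then show ?thesis
    by (simp add: borel_prod)
qed

text \<open>Supplies the \<open>r\<close> of \<open>factorization_AE\<close>: coordinates outside
  their Borel set are replaced by those of a fixed point, which exists because the law of zeta is a
  probability measure.\<close>

lemma zeta_space_retraction:
  obtains r where "r \<in> borel \<rightarrow>\<^sub>M zeta_space T" "\<And>z. z \<in> space (zeta_space T) \<Longrightarrow> r z = z"
proof -
  obtain z0 where z0: "z0 \<in> space (zeta_space T)"
    using prob_space.not_empty[OF prob_space_zeta_law] by (auto simp: space_zeta_law)
  define r where "r z = (\<lambda>k\<in>{0..num_dms T}. if z k \<in> prim_set T k then z k else z0 k)" for z
  have z0': "z0 k \<in> prim_set T k" if "k \<in> {0..num_dms T}" for k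
    using z0 that by (auto simp: zeta_space_def space_PiM prim_space_def space_restrict_space)
  have "r \<in> borel \<rightarrow>\<^sub>M zeta_space T"
    unfolding r_def zeta_space_def
  proof (rule measurable_restrict)
    fix k assume k: "k \<in> {0..num_dms T}"
    have [measurable]: "prim_set T k \<in> sets borel"
      using is_team k by (simp add: is_team_def)
    have "(\<lambda>z :: nat \<Rightarrow> 'z. if z k \<in> prim_set T k then z k else z0 k) \<in> borel \<rightarrow>\<^sub>M borel"
      by measurable
    then show "(\<lambda>z. if z k \<in> prim_set T k then z k else z0 k) \<in> borel \<rightarrow>\<^sub>M prim_space T k"
      unfolding prim_space_def by (rule measurable_restrict_space2[rotated]) (use z0'[OF k] in auto)
  qed
  moreover have "r z = z" if "z \<in> space (zeta_space T)" for z
    using that by (auto simp: r_def zeta_space_def space_PiM prim_space_def space_restrict_space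
        PiE_iff extensional_def fun_eq_iff)
  ultimately show thesis
    using that by blast
qed

definition stat_to_dyn :: "nat \<Rightarrow> (nat \<Rightarrow> 'y) \<times> (nat \<Rightarrow> 'u) \<Rightarrow> (nat \<Rightarrow> 'y) \<times> (nat \<Rightarrow> 'u)" where
  "stat_to_dyn i q =
     (\<lambda>j\<in>obs_idx T i. dyn_obs T j (fst q j) (restrict (snd q) (down T j)), snd q)"

text \<open>By nestedness the shared controls include all action arguments of \<open>g_j\<close> for
  every observation held, so the dynamic observations can be computed from the static information
  alone. This is exact and holds for every profile \<open>u\<close>.\<close>

lemma stat_to_dyn_info:
  assumes "i \<in> dms T"
  shows "stat_to_dyn i (info T PCS i z u) = info T PDCS i z u"
proof -
  have "down T i \<inter> down T j = down T j" if "j \<in> obs_idx T i" for j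
    using down_obs_idx[OF assms that] by blast
  then show ?thesis
    by (auto simp: stat_to_dyn_def info_def obs_def dynamic_def shared_idx_def control_sharing_def
        fun_eq_iff)
qed

lemma stat_to_dyn_measurable:
  assumes i: "i \<in> dms T"
  shows "stat_to_dyn i \<in> info_space T PCS i \<rightarrow>\<^sub>M info_space T PDCS i"
proof -
  have eq: "info_space T PDCS i = PiM (obs_idx T i) (dyn_obs_space T) \<Otimes>\<^sub>M PiM (down T i) (act_space T)"
    "info_space T PCS i = PiM (obs_idx T i) (stat_obs_space T) \<Otimes>\<^sub>M PiM (down T i) (act_space T)"
    by (simp_all add: info_space_def obs_space_def dynamic_def shared_idx_def control_sharing_def)
  show ?thesis
    unfolding stat_to_dyn_def[abs_def] eq
  proof (rule measurable_Pair, rule measurable_restrict)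
    fix j assume j: "j \<in> obs_idx T i"
    show "(\<lambda>q. dyn_obs T j (fst q j) (restrict (snd q) (down T j)))
        \<in> PiM (obs_idx T i) (stat_obs_space T) \<Otimes>\<^sub>M PiM (down T i) (act_space T) \<rightarrow>\<^sub>M dyn_obs_space T j"
      by (rule dyn_obs_measurable[OF _ _ measurable_snd down_obs_idx[OF i j]])
        (use obs_idx_subset_dms[OF i] j in \<open>auto intro: measurable_compose[OF measurable_fst]\<close>)
  qed simp
qed

text \<open>The dynamic information shows the realized controls, and once these are known each
  \<open>g_j\<close> can be inverted. So along the play of \<open>\<delta>\<close> it determines
  every static observation held, and \<open>factorization_AE\<close> turns this into a measurable
  map. The map is tied to \<open>\<delta>\<close> and is correct only almost surely along that
  play.\<close>

lemma dyn_to_stat: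
  assumes inv: "invertible_obs T" and \<delta>: "\<delta> \<in> policies T PCS" and i: "i \<in> dms T"
  obtains F where "F \<in> info_space T PDCS i \<rightarrow>\<^sub>M info_space T PCS i"
    "AE z in zeta_law T. F (info T PDCS i z (play T PCS \<delta> z)) = info T PCS i z (play T PCS \<delta> z)"
proof -
  let ?u = "play T PCS \<delta>"
  let ?\<Psi> = "\<lambda>z. info T PDCS i z (?u z)"
  interpret prob_space "zeta_law T" by (rule prob_space_zeta_law)
  obtain z0 where z0: "z0 \<in> space (zeta_space T)"
    using not_empty by (auto simp: space_zeta_law)
  obtain r where r: "r \<in> borel \<rightarrow>\<^sub>M zeta_space T" "\<And>z. z \<in> space (zeta_space T) \<Longrightarrow> r z = z"
    using zeta_space_retraction by blast
  have \<Psi>: "?\<Psi> \<in> zeta_space T \<rightarrow>\<^sub>M info_space T PDCS i"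
    by (rule info_measurable[OF i measurable_ident_sets[OF refl] play_measurable[OF \<delta>]
          down_subset_dms[OF i]])
  have stat_obs_set: "stat_obs T j z \<in> stat_obs_set T j"
    if "j \<in> dms T" "z \<in> space (zeta_space T)" for j z
    using measurable_space[OF stat_obs_measurable] that
    by (fastforce simp: stat_obs_space_def space_restrict_space)
  have "\<exists>F\<in>borel_measurable borel. AE z in zeta_law T. F (?\<Psi> z) = stat_obs T j z"
    if j: "j \<in> obs_idx T i" for j
  proof (rule factorization_AE[OF finite_measure_axioms])
    have dm: "j \<in> dms T" and sub: "down T j \<subseteq> down T i"
      using j obs_idx_subset_dms[OF i] down_obs_idx[OF i] by auto
    show "(\<lambda>z. z) \<in> borel_measurable (zeta_law T)" "r \<in> borel \<rightarrow>\<^sub>M zeta_law T"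
      "?\<Psi> \<in> borel_measurable (zeta_law T)"
      using zeta_space_borel r(1) measurable_compose[OF \<Psi> info_space_borel]
      by (simp_all add: measurable_zeta_law measurable_cong_sets[OF refl sets_zeta_law])
    have "(\<lambda>y. y) \<in> stat_obs_space T j \<rightarrow>\<^sub>M borel"
      unfolding stat_obs_space_def by (rule measurable_restrict_space1) simp
    from measurable_compose[OF stat_obs_measurable[OF dm] this]
    show "stat_obs T j \<in> borel_measurable (zeta_law T)"
      by (simp add: measurable_zeta_law)
    show "r z = z" if "z \<in> space (zeta_law T)" for z
      using that r(2) by (simp add: space_zeta_law)
    show "stat_obs T j z = stat_obs T j z'"
      if z: "z \<in> space (zeta_law T)" "z' \<in> space (zeta_law T)" and eq: "?\<Psi> z = ?\<Psi> z'" for z z'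
    proof -
      \<comment> \<open>Equal shared controls at \<open>z\<close> and \<open>z'\<close> mean that
        both dynamic observations arise from one and the same injective map, \<open>g_j\<close> at
        the actions \<open>?v\<close>.\<close>
      let ?v = "restrict (?u z) (down T j)"
      have "restrict (?u z) (down T i) = restrict (?u z') (down T i)"
        using eq by (simp add: info_def shared_idx_def control_sharing_def)
      then have "?u z k = ?u z' k" if "k \<in> down T j" for k
        using sub that by (metis restrict_apply' subsetD)
      then have v: "?v = restrict (?u z') (down T j)"
        by (auto simp: restrict_def)
      have "?v \<in> PiE (down T j) (act_set T)"
        using play_in_PiE[OF \<delta>, of z] z down_subset_dms[OF dm] by (auto simp: space_zeta_law PiE_iff)
      moreover have "dyn_obs T j (stat_obs T j z) ?v = dyn_obs T j (stat_obs T j z') ?v"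
        using fun_cong[OF arg_cong[OF eq, of fst], of j] j
        by (simp add: info_def obs_def dynamic_def v)
      ultimately show ?thesis
        using inv dm z unfolding invertible_obs_def space_zeta_law by (meson inj_on_def imageI)
    qed
  qed
  then have "\<forall>j\<in>obs_idx T i. \<exists>F. F \<in> borel_measurable borel \<and>
      (AE z in zeta_law T. F (?\<Psi> z) = stat_obs T j z)"
    by blast
  then obtain F where F: "\<And>j. j \<in> obs_idx T i \<Longrightarrow> F j \<in> borel_measurable borel"
    "\<And>j. j \<in> obs_idx T i \<Longrightarrow> AE z in zeta_law T. F j (?\<Psi> z) = stat_obs T j z"
    unfolding bchoice_iff by blast
  \<comment> \<open>\<open>F j\<close> may leave \<open>stat_obs_set T j\<close> on the exceptional
    set. The static observation at \<open>z0\<close> is substituted there, so that \<open>G\<close>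
    takes its values in the information space of \<open>PCS\<close>.\<close>
  define G where "G q = (\<lambda>j\<in>obs_idx T i. if F j q \<in> stat_obs_set T j then F j q else stat_obs T j z0, snd q)"
    for q
  have "G \<in> info_space T PDCS i \<rightarrow>\<^sub>M info_space T PCS i"
    unfolding G_def[abs_def]
  proof (subst (2) info_space_def, rule measurable_Pair, rule measurable_restrict)
    fix j assume j: "j \<in> obs_idx T i"
    then have dm: "j \<in> dms T" using obs_idx_subset_dms[OF i] by auto
    have [measurable]: "stat_obs_set T j \<in> sets borel"
      using is_team dm by (simp add: is_team_def)
    have [measurable]: "F j \<in> info_space T PDCS i \<rightarrow>\<^sub>M borel"
      by (rule measurable_compose[OF info_space_borel F(1)[OF j]])
    have "(\<lambda>q. if F j q \<in> stat_obs_set T j then F j q else stat_obs T j z0)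
        \<in> info_space T PDCS i \<rightarrow>\<^sub>M borel"
      by measurable
    then show "(\<lambda>q. if F j q \<in> stat_obs_set T j then F j q else stat_obs T j z0)
        \<in> info_space T PDCS i \<rightarrow>\<^sub>M obs_space T PCS j"
      unfolding obs_space_def stat_obs_space_def dynamic_def
      by (auto intro!: measurable_restrict_space2 stat_obs_set[OF dm z0])
  next
    show "snd \<in> info_space T PDCS i \<rightarrow>\<^sub>M PiM (shared_idx T PCS i) (act_space T)"
      by (simp add: info_space_def shared_idx_def control_sharing_def)
  qed
  moreover have "finite (obs_idx T i)"
    using obs_idx_subset_dms[OF i] by (rule finite_subset) simp
  then have "AE z in zeta_law T. \<forall>j\<in>obs_idx T i. F j (?\<Psi> z) = stat_obs T j z"
    using F(2) by (intro AE_finite_allI)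
  then have "AE z in zeta_law T. G (?\<Psi> z) = info T PCS i z (?u z)"
    using AE_space
  proof eventually_elim
    case (elim z)
    then show ?case
      using stat_obs_set[of _ z] obs_idx_subset_dms[OF i]
      by (auto simp: G_def info_def obs_def dynamic_def shared_idx_def control_sharing_def
          space_zeta_law fun_eq_iff)
  qed
  ultimately show thesis
    using that by blast
qed


section \<open>Plays of policies related by the reduction\<close>

lemma const_policy: "v \<in> act_set T i \<Longrightarrow> (\<lambda>_. v) \<in> dm_policies T p i"
  by (simp add: dm_policies_def act_space_def space_restrict_space)

text \<open>Finitely many null sets are merged, and profiles on \<open>down T j\<close> are replaced
  by full ones, so that whole plays can be inserted. One null set serves all profiles.\<close>

lemma cs_related_AE:
  assumes "cs_related T \<gamma> \<delta>"
  shows "AE z in zeta_law T. \<forall>j\<in>dms T. \<forall>u\<in>PiE (dms T) (act_set T).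
    \<gamma> j (info T PDCS j z u) = \<delta> j (info T PCS j z u)"
proof (rule AE_finite_allI)
  fix j assume j: "j \<in> dms T"
  have step: "\<gamma> j (info T PDCS j z u) = \<delta> j (info T PCS j z u)"
    if *: "\<forall>u\<in>PiE (down T j) (act_set T). \<gamma> j (info T PDCS j z u) = \<delta> j (info T PCS j z u)"
      and u: "u \<in> PiE (dms T) (act_set T)" for z u
  proof -
    have eq: "info T p j z (restrict u (down T j)) = info T p j z u" for p
      by (rule info_cong[OF j]) simp
    have "restrict u (down T j) \<in> PiE (down T j) (act_set T)"
      using u down_subset_dms[OF j] by (auto simp: PiE_iff)
    from bspec[OF * this] show ?thesis
      unfolding eq .
  qed
  have "AE z in zeta_law T. \<forall>u\<in>PiE (down T j) (act_set T).
      \<gamma> j (info T PDCS j z u) = \<delta> j (info T PCS j z u)"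
    using assms j unfolding cs_related_def by blast
  then show "AE z in zeta_law T. \<forall>u\<in>PiE (dms T) (act_set T).
      \<gamma> j (info T PDCS j z u) = \<delta> j (info T PCS j z u)"
    by (rule eventually_mono) (use step in blast)
qed simp

text \<open>
  Only the information along the realized play of \<open>\<delta>\<close> matters at the DM that deviates.
\<close>

lemma cs_related_play_update:
  assumes rel: "cs_related T \<gamma> \<delta>" and \<delta>: "\<delta>(i := \<beta>') \<in> policies T PCS"
    and \<beta>: "AE z in zeta_law T. \<beta> (info T PDCS i z (play T PCS (\<delta>(i := \<beta>')) z)) =
      \<beta>' (info T PCS i z (play T PCS (\<delta>(i := \<beta>')) z))"
  shows "AE z in zeta_law T. play T PDCS (\<gamma>(i := \<beta>)) z = play T PCS (\<delta>(i := \<beta>')) z"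
  using cs_related_AE[OF rel] \<beta> AE_space
proof eventually_elim
  case (elim z)
  then have "play T PCS (\<delta>(i := \<beta>')) z \<in> PiE (dms T) (act_set T)"
    using play_in_PiE[OF \<delta>] by (simp add: space_zeta_law)
  then show ?case
    using elim by (intro play_eqI) auto
qed

lemma cs_related_play:
  assumes rel: "cs_related T \<gamma> \<delta>" and \<delta>: "\<delta> \<in> policies T PCS"
  shows "AE z in zeta_law T. play T PDCS \<gamma> z = play T PCS \<delta> z"
  using cs_related_AE[OF rel] AE_space
proof eventually_elim
  case (elim z)
  then have "play T PCS \<delta> z \<in> PiE (dms T) (act_set T)"
    using play_in_PiE[OF \<delta>] by (simp add: space_zeta_law)
  then show ?case
    using elim by (intro play_eqI) auto
qed

text \<open>The null set of \<open>cs_related_AE\<close> is uniform in the profile, hence uniform in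
  \<open>v\<close>, as \<open>stationary_transfer\<close> demands.\<close>

lemma cs_related_play_const:
  assumes rel: "cs_related T \<gamma> \<delta>" and \<delta>: "\<delta> \<in> policies T PCS"
  shows "AE z in zeta_law T. \<forall>v\<in>act_set T i.
    play T PDCS (\<gamma>(i := \<lambda>_. v)) z = play T PCS (\<delta>(i := \<lambda>_. v)) z"
  using cs_related_AE[OF rel] AE_space
proof eventually_elim
  case (elim z)
  show ?case
  proof
    fix v assume "v \<in> act_set T i"
    then have "play T PCS (\<delta>(i := \<lambda>_. v)) z \<in> PiE (dms T) (act_set T)"
      using elim(2) by (intro play_in_PiE policies_update \<delta> const_policy) (simp_all add: space_zeta_law)
    then show "play T PDCS (\<gamma>(i := \<lambda>_. v)) z = play T PCS (\<delta>(i := \<lambda>_. v)) z"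
      using elim(1) by (intro play_eqI) auto
  qed
qed

section \<open>Transfer of the optimality notions between \<open>PDCS\<close> and
  \<open>PCS\<close>\<close>

context
  fixes \<gamma> \<delta>
  assumes inv: "invertible_obs T" and \<gamma>: "\<gamma> \<in> policies T PDCS" and \<delta>: "\<delta> \<in> policies T PCS"
    and rel: "cs_related T \<gamma> \<delta>"
begin

text \<open>The inverse \<open>F\<close> is taken along the play after the deviation, not along that
  of \<open>\<delta>\<close>, since this is where the new policy of DM \<open>i\<close> is
  evaluated.\<close>

lemma cs_deviation_stat_to_dyn:
  assumes i: "i \<in> dms T" and \<beta>: "\<beta> \<in> dm_policies T PCS i"
  shows "\<exists>\<beta>'\<in>dm_policies T PDCS i. J T PDCS (\<gamma>(i := \<beta>')) = J T PCS (\<delta>(i := \<beta>))"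
proof -
  have \<delta>': "\<delta>(i := \<beta>) \<in> policies T PCS"
    by (rule policies_update[OF \<delta> \<beta>])
  obtain F where F: "F \<in> info_space T PDCS i \<rightarrow>\<^sub>M info_space T PCS i"
    "AE z in zeta_law T. F (info T PDCS i z (play T PCS (\<delta>(i := \<beta>)) z)) =
      info T PCS i z (play T PCS (\<delta>(i := \<beta>)) z)"
    using dyn_to_stat[OF inv \<delta>' i] .
  show ?thesis
  proof (rule bexI)
    show "J T PDCS (\<gamma>(i := \<lambda>q. \<beta> (F q))) = J T PCS (\<delta>(i := \<beta>))"
      by (rule J_cong, rule cs_related_play_update[OF rel \<delta>'], use F(2) in eventually_elim) simp
    show "(\<lambda>q. \<beta> (F q)) \<in> dm_policies T PDCS i"
      using measurable_compose[OF F(1)] \<beta> by (simp add: dm_policies_def)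
  qed
qed

text \<open>In this direction no inversion is involved: DM \<open>i\<close> computes its dynamic
  information by \<open>stat_to_dyn\<close> and applies \<open>\<beta>\<close> to it.\<close>

lemma cs_deviation_dyn_to_stat:
  assumes i: "i \<in> dms T" and \<beta>: "\<beta> \<in> dm_policies T PDCS i"
  shows "\<exists>\<beta>'\<in>dm_policies T PCS i. J T PCS (\<delta>(i := \<beta>')) = J T PDCS (\<gamma>(i := \<beta>))"
proof (rule bexI)
  show \<beta>': "(\<lambda>q. \<beta> (stat_to_dyn i q)) \<in> dm_policies T PCS i"
    using measurable_compose[OF stat_to_dyn_measurable[OF i]] \<beta> by (simp add: dm_policies_def)
  show "J T PCS (\<delta>(i := \<lambda>q. \<beta> (stat_to_dyn i q))) = J T PDCS (\<gamma>(i := \<beta>))"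
    by (rule J_cong[symmetric], rule cs_related_play_update[OF rel policies_update[OF \<delta> \<beta>']])
      (simp add: stat_to_dyn_info[OF i])
qed

lemma cs_pbp_optimal_iff: "pbp_optimal T PDCS \<gamma> \<longleftrightarrow> pbp_optimal T PCS \<delta>"
proof
  have eq: "J T PDCS \<gamma> = J T PCS \<delta>"
    by (rule J_cong[OF cs_related_play[OF rel \<delta>]])
  show "pbp_optimal T PCS \<delta>" if "pbp_optimal T PDCS \<gamma>"
    by (rule pbp_optimal_transfer[OF that \<delta> eq cs_deviation_stat_to_dyn])
  show "pbp_optimal T PDCS \<gamma>" if "pbp_optimal T PCS \<delta>"
    by (rule pbp_optimal_transfer[OF that \<gamma> eq[symmetric] cs_deviation_dyn_to_stat])
qed

text \<open>Every policy of one problem has one of equal cost in the other. From \<open>PCS\<close>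
  to \<open>PDCS\<close> each DM reconstructs its static information along the play of the policy
  itself, which reproduces that play almost surely. In the other direction
  \<open>stat_to_dyn\<close> gives equal plays for every value of zeta.\<close>

lemma cs_globally_optimal_iff: "globally_optimal T PDCS \<gamma> \<longleftrightarrow> globally_optimal T PCS \<delta>"
proof -
  have 1: "\<exists>\<beta>'\<in>policies T PDCS. J T PDCS \<beta>' = J T PCS \<beta>" if \<beta>: "\<beta> \<in> policies T PCS" for \<beta>
  proof -
    have "\<exists>F. F \<in> info_space T PDCS i \<rightarrow>\<^sub>M info_space T PCS i \<and>
        (AE z in zeta_law T. F (info T PDCS i z (play T PCS \<beta> z)) = info T PCS i z (play T PCS \<beta> z))"
      if "i \<in> dms T" for i
      by (rule dyn_to_stat[OF inv \<beta> that]) blast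
    then have "\<forall>i\<in>dms T. \<exists>F. F \<in> info_space T PDCS i \<rightarrow>\<^sub>M info_space T PCS i \<and>
        (AE z in zeta_law T. F (info T PDCS i z (play T PCS \<beta> z)) = info T PCS i z (play T PCS \<beta> z))"
      by blast
    then obtain F where F: "\<And>i. i \<in> dms T \<Longrightarrow> F i \<in> info_space T PDCS i \<rightarrow>\<^sub>M info_space T PCS i"
      "\<And>i. i \<in> dms T \<Longrightarrow> AE z in zeta_law T.
        F i (info T PDCS i z (play T PCS \<beta> z)) = info T PCS i z (play T PCS \<beta> z)"
      unfolding bchoice_iff by blast
    have "AE z in zeta_law T. \<forall>i\<in>dms T.
        F i (info T PDCS i z (play T PCS \<beta> z)) = info T PCS i z (play T PCS \<beta> z)"
      using F(2) by (intro AE_finite_allI) auto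
    then have "AE z in zeta_law T. play T PDCS (\<lambda>i q. \<beta> i (F i q)) z = play T PCS \<beta> z"
      by eventually_elim (rule play_eqI, simp)
    moreover have "(\<lambda>i q. \<beta> i (F i q)) \<in> policies T PDCS"
      unfolding policies_def dm_policies_def
    proof (intro CollectI ballI)
      fix i assume i: "i \<in> dms T"
      have "\<beta> i \<in> info_space T PCS i \<rightarrow>\<^sub>M act_space T i"
        using \<beta> i by (simp add: policies_def dm_policies_def)
      then show "(\<lambda>q. \<beta> i (F i q)) \<in> info_space T PDCS i \<rightarrow>\<^sub>M act_space T i"
        by (rule measurable_compose[OF F(1)[OF i]])
    qed
    ultimately show ?thesis
      using J_cong by blast
  qed
  have 2: "\<exists>\<beta>'\<in>policies T PCS. J T PCS \<beta>' = J T PDCS \<beta>" if \<beta>: "\<beta> \<in> policies T PDCS" for \<beta>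
  proof (rule bexI)
    show "(\<lambda>i q. \<beta> i (stat_to_dyn i q)) \<in> policies T PCS"
      unfolding policies_def dm_policies_def
    proof (intro CollectI ballI)
      fix i assume i: "i \<in> dms T"
      have "\<beta> i \<in> info_space T PDCS i \<rightarrow>\<^sub>M act_space T i"
        using \<beta> i by (simp add: policies_def dm_policies_def)
      then show "(\<lambda>q. \<beta> i (stat_to_dyn i q)) \<in> info_space T PCS i \<rightarrow>\<^sub>M act_space T i"
        by (rule measurable_compose[OF stat_to_dyn_measurable[OF i]])
    qed
    show "J T PCS (\<lambda>i q. \<beta> i (stat_to_dyn i q)) = J T PDCS \<beta>"
      by (rule J_cong, rule AE_I2, rule play_eqI) (simp add: stat_to_dyn_info)
  qed
  have eq: "J T PDCS \<gamma> = J T PCS \<delta>"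
    by (rule J_cong[OF cs_related_play[OF rel \<delta>]])
  show ?thesis
    using globally_optimal_transfer[OF _ \<delta> eq 1] globally_optimal_transfer[OF _ \<gamma> eq[symmetric] 2]
    by (rule iffI)
qed

text \<open>Along the play the two informations are functions of each other: by
  \<open>stat_to_dyn\<close> in one direction, and by the almost sure inverse along the play of
  \<open>\<delta>\<close> in the other.\<close>

lemma cs_stationary_iff: "stationary T PDCS \<gamma> \<longleftrightarrow> stationary T PCS \<delta>"
proof -
  have play: "AE z in zeta_law T. play T PDCS \<gamma> z = play T PCS \<delta> z"
    by (rule cs_related_play[OF rel \<delta>])
  have const: "AE z in zeta_law T. \<forall>v\<in>act_set T i.
      play T PDCS (\<gamma>(i := \<lambda>_. v)) z = play T PCS (\<delta>(i := \<lambda>_. v)) z" for i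
    by (rule cs_related_play_const[OF rel \<delta>])
  have H: "\<exists>H\<in>info_space T PCS i \<rightarrow>\<^sub>M info_space T PDCS i.
      AE z in zeta_law T. H (closed_info T PCS \<delta> i z) = closed_info T PDCS \<gamma> i z" if "i \<in> dms T" for i
  proof (rule bexI[OF _ stat_to_dyn_measurable[OF that]])
    show "AE z in zeta_law T. stat_to_dyn i (closed_info T PCS \<delta> i z) = closed_info T PDCS \<gamma> i z"
      using play by eventually_elim (simp add: closed_info_def stat_to_dyn_info[OF that])
  qed
  have K: "\<exists>K\<in>info_space T PDCS i \<rightarrow>\<^sub>M info_space T PCS i.
      AE z in zeta_law T. K (closed_info T PDCS \<gamma> i z) = closed_info T PCS \<delta> i z" if i: "i \<in> dms T" for i
  proof -
    obtain F where F: "F \<in> info_space T PDCS i \<rightarrow>\<^sub>M info_space T PCS i"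
      "AE z in zeta_law T. F (info T PDCS i z (play T PCS \<delta> z)) = info T PCS i z (play T PCS \<delta> z)"
      using dyn_to_stat[OF inv \<delta> i] .
    show ?thesis
    proof (rule bexI[OF _ F(1)])
      show "AE z in zeta_law T. F (closed_info T PDCS \<gamma> i z) = closed_info T PCS \<delta> i z"
        using play F(2) by eventually_elim (simp add: closed_info_def)
    qed
  qed
  show ?thesis
  proof
    show "stationary T PCS \<delta>" if "stationary T PDCS \<gamma>"
      by (rule stationary_transfer[OF that \<delta> play const H K])
    have "AE z in zeta_law T. play T PCS \<delta> z = play T PDCS \<gamma> z"
      using play by eventually_elim simp
    moreover have "AE z in zeta_law T. \<forall>v\<in>act_set T i.
        play T PCS (\<delta>(i := \<lambda>_. v)) z = play T PDCS (\<gamma>(i := \<lambda>_. v)) z" for i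
      using const[of i] by eventually_elim simp
    ultimately show "stationary T PDCS \<gamma>" if "stationary T PCS \<delta>"
      by (rule stationary_transfer[OF that \<gamma> _ _ K H])
  qed
qed

end
end

section \<open>Ignoring and recomputing the shared controls\<close>

context nested_team
begin

section \<open>The pairs \<open>PD\<close>, \<open>PDCS\<close> and \<open>PS\<close>,
  \<open>PCS\<close> treated at once\<close>

context
  fixes p q
  assumes p: "\<not> control_sharing p" and q: "control_sharing q" and dyn: "dynamic p = dynamic q"
begin

lemma obs_eq: "obs T q = obs T p" and obs_space_eq: "obs_space T q = obs_space T p"
  by (simp_all add: fun_eq_iff obs_def obs_space_def dyn)

lemma info_without: "info T p i z u = (\<lambda>j\<in>obs_idx T i. obs T p j z u, restrict u {})"
  and info_with: "info T q i z u = (\<lambda>j\<in>obs_idx T i. obs T p j z u, restrict u (down T i))"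
  using p q by (simp_all add: info_def shared_idx_def obs_eq)

lemma info_space_without:
    "info_space T p i = PiM (obs_idx T i) (obs_space T p) \<Otimes>\<^sub>M PiM {} (act_space T)"
  and info_space_with:
    "info_space T q i = PiM (obs_idx T i) (obs_space T p) \<Otimes>\<^sub>M PiM (down T i) (act_space T)"
  using p q by (simp_all add: info_space_def shared_idx_def obs_space_eq)

lemma ignore_controls_info: "ignore_controls \<gamma> i (info T q i z u) = \<gamma> i (info T p i z u)"
  by (simp add: ignore_controls_def info_with info_without)

definition forget_controls :: "(nat \<Rightarrow> 'y) \<times> (nat \<Rightarrow> 'u) \<Rightarrow> (nat \<Rightarrow> 'y) \<times> (nat \<Rightarrow> 'u)" where
  "forget_controls x = (fst x, restrict (snd x) {})"

lemma forget_controls_info: "forget_controls (info T q i z u) = info T p i z u"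
  by (simp add: forget_controls_def info_with info_without)

lemma forget_controls_measurable: "forget_controls \<in> info_space T q i \<rightarrow>\<^sub>M info_space T p i"
  unfolding forget_controls_def[abs_def] info_space_with info_space_without
  by (rule measurable_Pair[OF measurable_fst measurable_compose[OF measurable_snd]])
    (rule measurable_restrict_subset, simp)

lemma ignore_controls_policies:
  assumes "\<gamma> \<in> policies T p"
  shows "ignore_controls \<gamma> \<in> policies T q"
  unfolding policies_def dm_policies_def
proof (intro CollectI ballI)
  fix i assume i: "i \<in> dms T"
  have "\<gamma> i \<in> info_space T p i \<rightarrow>\<^sub>M act_space T i"
    using assms i by (simp add: policies_def dm_policies_def)
  then have "(\<lambda>x. \<gamma> i (forget_controls x)) \<in> info_space T q i \<rightarrow>\<^sub>M act_space T i"
    by (rule measurable_compose[OF forget_controls_measurable])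
  also have "(\<lambda>x. \<gamma> i (forget_controls x)) = ignore_controls \<gamma> i"
    by (simp add: fun_eq_iff ignore_controls_def forget_controls_def)
  finally show "ignore_controls \<gamma> i \<in> info_space T q i \<rightarrow>\<^sub>M act_space T i" .
qed

text \<open>
  By nestedness a DM knows the observations of the DMs in its \<open>down\<close> set, so it can recompute
  their actions from their policies.
\<close>

definition recall_controls ::
  "('y, 'u) policy \<Rightarrow> nat \<Rightarrow> (nat \<Rightarrow> 'y) \<times> (nat \<Rightarrow> 'u) \<Rightarrow> (nat \<Rightarrow> 'y) \<times> (nat \<Rightarrow> 'u)" where
  "recall_controls \<gamma> i x =
     (fst x, \<lambda>k\<in>down T i. \<gamma> k (restrict (fst x) (obs_idx T k), restrict (snd x) {}))"

text \<open>Only the DMs in \<open>down T i\<close> have to follow \<open>\<gamma>\<close> in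
  \<open>u\<close>, so the identity survives any deviation of DM \<open>i\<close> itself. Their
  information is contained in that of DM \<open>i\<close>, and restriction recovers it.\<close>

lemma recall_controls_info:
  assumes i: "i \<in> dms T" and u: "\<And>k. k \<in> down T i \<Longrightarrow> u k = \<gamma> k (info T p k z u)"
  shows "recall_controls \<gamma> i (info T p i z u) = info T q i z u"
proof -
  let ?x = "info T p i z u"
  have "\<gamma> k (restrict (fst ?x) (obs_idx T k), restrict (snd ?x) {}) = u k" if k: "k \<in> down T i" for k
  proof -
    have "(restrict (fst ?x) (obs_idx T k), restrict (snd ?x) {}) = info T p k z u"
      using down_trans(2)[OF i k] by (auto simp: info_without restrict_def fun_eq_iff)
    then show ?thesis
      using u[OF k] by simp
  qed
  then have "(\<lambda>k\<in>down T i. \<gamma> k (restrict (fst ?x) (obs_idx T k), restrict (snd ?x) {})) =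
      restrict u (down T i)"
    by (rule restrict_ext)
  then show ?thesis
    unfolding recall_controls_def info_with by (simp only: info_without fst_conv)
qed

lemma recall_controls_measurable:
  assumes \<gamma>: "\<gamma> \<in> policies T p" and i: "i \<in> dms T"
  shows "recall_controls \<gamma> i \<in> info_space T p i \<rightarrow>\<^sub>M info_space T q i"
  unfolding recall_controls_def[abs_def] info_space_with
proof (rule measurable_Pair, unfold info_space_without, rule measurable_fst, rule measurable_restrict,
    fold info_space_without)
  fix k assume k: "k \<in> down T i"
  have "k \<in> dms T"
    using down_subset_dms[OF i] k by auto
  then have \<gamma>k: "\<gamma> k \<in> info_space T p k \<rightarrow>\<^sub>M act_space T k"
    using \<gamma> by (auto simp: policies_def dm_policies_def)
  have "(\<lambda>x. (restrict (fst x) (obs_idx T k), restrict (snd x) {})) \<in> info_space T p i \<rightarrow>\<^sub>M info_space T p k"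
    unfolding info_space_without
    by (rule measurable_Pair[OF measurable_compose[OF measurable_fst measurable_restrict_subset[OF down_trans(2)[OF i k]]]
          measurable_compose[OF measurable_snd measurable_restrict_subset[OF subset_refl]]])
  from measurable_compose[OF this \<gamma>k]
  show "(\<lambda>x. \<gamma> k (restrict (fst x) (obs_idx T k), restrict (snd x) {})) \<in> info_space T p i \<rightarrow>\<^sub>M act_space T k" .
qed

lemma play_ignore_controls: "play T p \<gamma> z = play T q (ignore_controls \<gamma>) z"
  by (rule play_eqI) (simp add: ignore_controls_info)

lemma play_ignore_controls_const:
  "play T p (\<gamma>(i := \<lambda>_. v)) z = play T q ((ignore_controls \<gamma>)(i := \<lambda>_. v)) z"
  by (rule play_eqI) (simp add: ignore_controls_info)

lemma play_recall_controls:
  assumes i: "i \<in> dms T"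
  shows "play T p (\<gamma>(i := \<lambda>x. \<beta> (recall_controls \<gamma> i x))) z =
    play T q ((ignore_controls \<gamma>)(i := \<beta>)) z"
proof (rule play_eqI)
  let ?u = "play T q ((ignore_controls \<gamma>)(i := \<beta>)) z"
  fix j assume "j \<in> dms T"
  \<comment> \<open>The DMs in \<open>down T i\<close> act before DM \<open>i\<close>, hence still
    follow \<open>\<gamma>\<close> when DM \<open>i\<close> deviates.\<close>
  have "?u k = \<gamma> k (info T p k z ?u)" if k: "k \<in> down T i" for k
  proof -
    have "k \<noteq> i" "k \<in> dms T"
      using down_subset[OF i] down_subset_dms[OF i] k by auto
    then show ?thesis
      using play_eq[of k q "(ignore_controls \<gamma>)(i := \<beta>)" z] by (simp add: ignore_controls_info)
  qed
  then show "(\<gamma>(i := \<lambda>x. \<beta> (recall_controls \<gamma> i x))) j (info T p j z ?u) =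
      ((ignore_controls \<gamma>)(i := \<beta>)) j (info T q j z ?u)"
    using recall_controls_info[OF i] by (simp add: ignore_controls_info)
qed

lemma pbp_optimal_ignore_controls:
  assumes "pbp_optimal T p \<gamma>"
  shows "pbp_optimal T q (ignore_controls \<gamma>)"
proof (rule pbp_optimal_transfer[OF assms])
  have \<gamma>: "\<gamma> \<in> policies T p"
    using assms by (simp add: pbp_optimal_def)
  then show "ignore_controls \<gamma> \<in> policies T q"
    by (rule ignore_controls_policies)
  show "J T p \<gamma> = J T q (ignore_controls \<gamma>)"
    by (rule J_cong) (simp add: play_ignore_controls)
  fix i \<beta> assume i: "i \<in> dms T" and \<beta>: "\<beta> \<in> dm_policies T q i"
  have "(\<lambda>x. \<beta> (recall_controls \<gamma> i x)) \<in> dm_policies T p i"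
    using measurable_compose[OF recall_controls_measurable[OF \<gamma> i]] \<beta> unfolding dm_policies_def .
  moreover have "J T p (\<gamma>(i := \<lambda>x. \<beta> (recall_controls \<gamma> i x))) = J T q ((ignore_controls \<gamma>)(i := \<beta>))"
    by (rule J_cong) (simp add: play_recall_controls[OF i])
  ultimately show "\<exists>\<beta>'\<in>dm_policies T p i. J T p (\<gamma>(i := \<beta>')) = J T q ((ignore_controls \<gamma>)(i := \<beta>))"
    by blast
qed

text \<open>Along the play the informations with and without sharing determine each other, by
  \<open>forget_controls\<close> and \<open>recall_controls\<close>, so the conditioning is the
  same. A constant deviation is the same policy in both problems.\<close>

lemma stationary_ignore_controls:
  assumes "stationary T p \<gamma>"
  shows "stationary T q (ignore_controls \<gamma>)"
proof (rule stationary_transfer[OF assms])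
  have \<gamma>: "\<gamma> \<in> policies T p"
    using assms by (simp add: stationary_def)
  then show "ignore_controls \<gamma> \<in> policies T q"
    by (rule ignore_controls_policies)
  show "AE z in zeta_law T. play T p \<gamma> z = play T q (ignore_controls \<gamma>) z"
    by (simp add: play_ignore_controls)
  fix i assume i: "i \<in> dms T"
  show "AE z in zeta_law T. \<forall>v\<in>act_set T i.
      play T p (\<gamma>(i := \<lambda>_. v)) z = play T q ((ignore_controls \<gamma>)(i := \<lambda>_. v)) z"
    by (simp add: play_ignore_controls_const)
  have "forget_controls (closed_info T q (ignore_controls \<gamma>) i z) = closed_info T p \<gamma> i z" for z
    by (simp add: closed_info_def forget_controls_info play_ignore_controls)
  then show "\<exists>H\<in>info_space T q i \<rightarrow>\<^sub>M info_space T p i.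
      AE z in zeta_law T. H (closed_info T q (ignore_controls \<gamma>) i z) = closed_info T p \<gamma> i z"
    using forget_controls_measurable by (auto intro!: bexI[of _ forget_controls])
  have "recall_controls \<gamma> i (closed_info T p \<gamma> i z) = closed_info T q (ignore_controls \<gamma>) i z" for z
    unfolding closed_info_def play_ignore_controls[symmetric]
    by (rule recall_controls_info[OF i]) (use play_eq down_subset_dms[OF i] in blast)
  then show "\<exists>K\<in>info_space T p i \<rightarrow>\<^sub>M info_space T q i.
      AE z in zeta_law T. K (closed_info T p \<gamma> i z) = closed_info T q (ignore_controls \<gamma>) i z"
    using recall_controls_measurable[OF \<gamma> i] by (auto intro!: bexI[of _ "recall_controls \<gamma> i"])
qed

end
end

section \<open>A team in which control sharing carries a threat\<close>

text \<open>
  The cost is flat in $u^2$ where $u^1 = 0$, and flat in $u^1$ where $u^2 = 1$.  So the threat to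
  answer any nonzero $u^1$ by $u^2 = 1$ fixes the cost at 1 under all deviations of a single DM; with
  $u^2 = 0$ throughout it is $(1 + u^1)^2$.
\<close>

definition threat_team :: "(real, real, real, real) team" where
  "threat_team = \<lparr>num_dms = 2, prim_prob = return borel 0,
     prim_set = (\<lambda>_. UNIV), prim_rv = (\<lambda>_ _. 0), act_euclid = (\<lambda>_. UNIV), act_set = (\<lambda>_. UNIV),
     stat_obs_set = (\<lambda>_. UNIV), dyn_obs_set = (\<lambda>_. UNIV), down = (\<lambda>i. if i = 2 then {1} else {}),
     stat_obs = (\<lambda>_ _. 0), dyn_obs = (\<lambda>i s u. if i = 2 then s + u 1 else s),
     cost = (\<lambda>_ u. (1 + u 1 * (1 - u 2))\<^sup>2)\<rparr>"

definition threat_policy :: "(real, real) policy" where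
  "threat_policy i x = (if i = 2 \<and> snd x 1 \<noteq> 0 then 1 else 0)"

definition idle_policy :: "(real, real) policy" where
  "idle_policy = (\<lambda>_ _. 0)"

lemma threat_team_simps [simp]:
  "num_dms threat_team = 2" "prim_prob threat_team = return borel 0"
  "prim_set threat_team = (\<lambda>_. UNIV)" "prim_rv threat_team = (\<lambda>_ _. 0)"
  "act_euclid threat_team = (\<lambda>_. UNIV)" "act_set threat_team = (\<lambda>_. UNIV)"
  "stat_obs_set threat_team = (\<lambda>_. UNIV)" "dyn_obs_set threat_team = (\<lambda>_. UNIV)"
  "down threat_team = (\<lambda>i. if i = 2 then {1} else {})"
  "stat_obs threat_team = (\<lambda>_ _. 0)" "dyn_obs threat_team = (\<lambda>i s u. if i = 2 then s + u 1 else s)"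
  "cost threat_team = (\<lambda>_ u. (1 + u 1 * (1 - u 2))\<^sup>2)"
  by (simp_all add: threat_team_def)

lemma threat_team_spaces [simp]:
  "prim_space threat_team = (\<lambda>_. borel)" "act_space threat_team = (\<lambda>_. borel)"
  "stat_obs_space threat_team = (\<lambda>_. borel)" "dyn_obs_space threat_team = (\<lambda>_. borel)"
proof -
  have "restrict_space borel UNIV = (borel :: real measure)"
    by (rule measure_eqI) (simp_all add: emeasure_restrict_space)
  then show "prim_space threat_team = (\<lambda>_. borel)" "act_space threat_team = (\<lambda>_. borel)"
    "stat_obs_space threat_team = (\<lambda>_. borel)" "dyn_obs_space threat_team = (\<lambda>_. borel)"
    by (simp_all add: fun_eq_iff prim_space_def act_space_def stat_obs_space_def dyn_obs_space_def)
qed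

context
  notes One_nat_def [simp del]
begin

lemma is_team_threat_team: "is_team threat_team"
proof -
  \<comment> \<open>For the clause that \<open>down\<close> records genuine influence: raising
    \<open>u 1\<close> from 0 to 1 moves the observation of DM 2.\<close>
  have "\<exists>z\<in>space (zeta_space threat_team). \<exists>u\<in>PiE {1} (\<lambda>_. UNIV). \<exists>v :: real.
      0 + (u(1 := v)) 1 \<noteq> 0 + u (1 :: nat)"
  proof (intro bexI exI)
    show "(\<lambda>k\<in>{0..2}. 0) \<in> space (zeta_space threat_team)"
      by (simp add: zeta_space_def space_PiM)
    show "(\<lambda>k\<in>{1}. 0 :: real) \<in> PiE {1} (\<lambda>_. UNIV)"
      by simp
    show "0 + ((\<lambda>k\<in>{1}. 0 :: real)(1 := 1)) 1 \<noteq> 0 + (\<lambda>k\<in>{1}. 0) (1 :: nat)"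
      by simp
  qed
  moreover have "(\<lambda>(s :: real, u). s + u 1) \<in> borel \<Otimes>\<^sub>M PiM {1 :: nat} (\<lambda>_. borel) \<rightarrow>\<^sub>M borel"
    by (simp add: split_beta')
  moreover have "(\<lambda>(x :: real, u :: nat \<Rightarrow> real). (1 + u 1 * (1 - u 2))\<^sup>2)
      \<in> borel \<Otimes>\<^sub>M PiM {1..2} (\<lambda>_. borel) \<rightarrow>\<^sub>M borel"
    by (simp add: split_beta')
  ultimately show ?thesis
    by (auto simp: is_team_def prob_space_return split_beta')
qed

lemma obs_idx_threat_team: "obs_idx threat_team i = (if i = 2 then {1, 2} else {i})"
proof -
  have "{(a, b). b \<in> down threat_team a} = {(2, 1)}"
    by (auto split: if_splits)
  moreover have "{(2 :: nat, 1 :: nat)}\<^sup>* = Id \<union> {(2, 1)}"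
    by (auto simp: rtrancl_eq_or_trancl trancl_insert)
  ultimately show ?thesis
    unfolding obs_idx_def by auto
qed

lemma pn_team_threat_team: "pn_team threat_team"
proof -
  have "i = 2 \<and> k = 1" if "k \<in> affecting threat_team p i" for p i k
    using that by (auto simp: affecting_def shared_idx_def obs_idx_threat_team split: if_splits)
  then have "partially_nested threat_team p" for p
    by (fastforce simp: partially_nested_def shared_idx_def obs_idx_threat_team)
  then show ?thesis
    using is_team_threat_team by (simp add: pn_team_def)
qed

interpretation threat: nested_team threat_team
  by (unfold_locales) (rule pn_team_threat_team)

lemma invertible_threat_team: "invertible_obs threat_team"
  by (auto simp: invertible_obs_def inj_on_def)

lemma zeta_threat_team: "zeta threat_team w = (\<lambda>k\<in>{0..2}. 0)"
  by (simp add: zeta_def)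

lemma J_threat_team:
  assumes "\<And>z. (1 + play threat_team p \<gamma> z 1 * (1 - play threat_team p \<gamma> z 2))\<^sup>2 = c"
  shows "J threat_team p \<gamma> = ennreal c"
proof -
  interpret prob_space "return borel (0 :: real)"
    by (simp add: prob_space_return)
  show ?thesis
    using emeasure_space_1 by (simp add: J_def closed_cost_def assms)
qed

text \<open>All primitive variables vanish, so the law of zeta is a point mass.\<close>

lemma emeasure_zeta_law_threat_team:
  assumes "A \<in> sets (zeta_space threat_team)"
  shows "emeasure (zeta_law threat_team) A = indicator A (\<lambda>k\<in>{0..2}. 0)"
proof -
  have "zeta threat_team -` A \<inter> UNIV \<in> sets borel"
    using measurable_sets[OF threat.zeta_measurable assms] by simp
  then show ?thesis
    using assms threat.zeta_measurable
    by (simp add: zeta_law_def emeasure_distr zeta_threat_team indicator_def vimage_def)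
qed

text \<open>Under a point mass every event has probability 0 or 1 and so is independent of all
  others; the unconditional law therefore serves as conditional law given any
  \<open>Y\<close>.\<close>

lemma regular_cond_distr_threat_team:
  assumes Y: "Y \<in> zeta_space threat_team \<rightarrow>\<^sub>M N"
  shows "regular_cond_distr (zeta_law threat_team) N Y (\<lambda>_. zeta_law threat_team)"
proof -
  let ?M = "zeta_law threat_team"
  interpret prob_space ?M by (rule threat.prob_space_zeta_law)
  interpret finite_measure_subalgebra ?M "vimage_algebra (space ?M) Y N"
    by (rule finite_measure_subalgebra_vimage[OF finite_measure_axioms]) (simp add: threat.measurable_zeta_law Y)
  have "AE z in ?M. emeasure ?M B = nn_cond_exp ?M (vimage_algebra (space ?M) Y N) (indicator B) z"
    if B: "B \<in> sets ?M" for B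
  proof (rule nn_cond_exp_charact)
    fix A assume "A \<in> sets (vimage_algebra (space ?M) Y N)"
    then have A: "A \<in> sets ?M"
      using subalg by (auto simp: subalgebra_def)
    have "(\<integral>\<^sup>+z\<in>A. indicator B z \<partial>?M) = emeasure ?M (B \<inter> A)"
      using A B by (simp add: indicator_inter_arith[symmetric])
    also have "\<dots> = emeasure ?M B * emeasure ?M A"
      using A B sets.Int[OF B A]
      by (simp add: threat.sets_zeta_law emeasure_zeta_law_threat_team indicator_def)
    finally show "(\<integral>\<^sup>+z\<in>A. indicator B z \<partial>?M) = (\<integral>\<^sup>+z\<in>A. emeasure ?M B \<partial>?M)"
      using A by (simp add: nn_integral_cmult_indicator)
  qed (use B in auto)
  moreover have "?M \<in> space (prob_algebra ?M)"
    by (simp add: space_prob_algebra prob_space_axioms)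
  ultimately show ?thesis
    by (simp add: regular_cond_distr_def)
qed

section \<open>The idle policy is neither pbp optimal nor stationary\<close>

lemma idle_policies: "idle_policy \<in> policies threat_team p"
  by (simp add: idle_policy_def policies_def dm_policies_def)

lemma idle_deviation_cost:
  "(1 + play threat_team p (idle_policy(1 := \<lambda>_. v)) z 1 *
     (1 - play threat_team p (idle_policy(1 := \<lambda>_. v)) z 2))\<^sup>2 = (1 + v)\<^sup>2"
  by (simp add: threat.play_eq idle_policy_def)

lemma idle_not_pbp_optimal: "\<not> pbp_optimal threat_team p idle_policy"
proof
  assume "pbp_optimal threat_team p idle_policy"
  \<comment> \<open>\<open>-1\<close> is the zero of \<open>(1 + v)^2\<close>, the cost after the
    constant deviation \<open>v\<close> of DM 1.\<close>
  moreover have "(\<lambda>_. -1) \<in> dm_policies threat_team p 1"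
    by (rule threat.const_policy) simp
  ultimately have "J threat_team p idle_policy \<le> J threat_team p (idle_policy(1 := \<lambda>_. -1))"
    by (auto simp: threat.pbp_optimal_iff)
  moreover have "J threat_team p (idle_policy(1 := \<lambda>_. -1)) = ennreal 0"
    by (rule J_threat_team) (simp add: idle_deviation_cost)
  moreover have "J threat_team p idle_policy = ennreal 1"
    by (rule J_threat_team) (simp add: threat.play_eq idle_policy_def)
  ultimately show False
    by simp
qed

text \<open>Stationarity asks for some \<open>\<kappa>\<close>, so every candidate has to be
  refuted. The cost after a constant deviation \<open>v\<close> of DM 1 is \<open>(1 + v)^2\<close>
  for every value of zeta, so integration against any probability measure returns it, and its
  derivative at 0 is 2.\<close>

lemma idle_not_stationary: "\<not> stationary threat_team p idle_policy"
proof
  assume stat: "stationary threat_team p idle_policy"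
  have "1 \<in> dms threat_team"
    by simp
  from bspec[OF conjunct2[OF stat[unfolded stationary_def]] this] obtain \<kappa> where
    \<kappa>: "regular_cond_distr (zeta_law threat_team) (info_space threat_team p 1)
      (closed_info threat_team p idle_policy 1) \<kappa>" and
    grad: "AE z in zeta_law threat_team. zero_gradient (act_euclid threat_team 1) (act_set threat_team 1)
      (\<lambda>u. \<integral>\<^sup>+ z'. closed_cost threat_team p (idle_policy(1 := (\<lambda>_. u))) z'
         \<partial>\<kappa> (closed_info threat_team p idle_policy 1 z))
      (idle_policy 1 (closed_info threat_team p idle_policy 1 z))"
    by (elim exE conjE)
  interpret prob_space "zeta_law threat_team" by (rule threat.prob_space_zeta_law)
  \<comment> \<open>The vanishing gradient is given only almost everywhere; a contradiction at those
    points suffices, since under a probability measure \<open>False\<close> cannot hold almost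
    everywhere.\<close>
  have "AE z in zeta_law threat_team. False"
    using grad AE_space
  proof eventually_elim
    case (elim z)
    let ?K = "\<kappa> (closed_info threat_team p idle_policy 1 z)"
    have "closed_info threat_team p idle_policy 1 z \<in> space (info_space threat_team p 1)"
      using measurable_space[OF threat.closed_info_measurable[OF idle_policies, of 1 p] elim(2)[unfolded threat.space_zeta_law]]
      by simp
    then have "?K \<in> space (prob_algebra (zeta_law threat_team))"
      by (rule measurable_space[OF conjunct1[OF \<kappa>[unfolded regular_cond_distr_def]]])
    then interpret K: prob_space ?K
      by (simp add: space_prob_algebra)
    have "(\<integral>\<^sup>+ z'. closed_cost threat_team p (idle_policy(1 := (\<lambda>_. u))) z' \<partial>?K) = ennreal ((1 + u)\<^sup>2)" for u
      using K.emeasure_space_1 by (simp add: closed_cost_def idle_deviation_cost)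
    then obtain S where S: "open S" "0 \<in> S"
      "((\<lambda>v :: real. (1 + v)\<^sup>2) has_derivative (\<lambda>_. 0)) (at 0 within S)"
      using elim(1) by (auto simp: zero_gradient_def idle_policy_def)
    have "((\<lambda>v :: real. (1 + v)\<^sup>2) has_real_derivative 0) (at 0)"
      by (rule has_derivative_imp_has_field_derivative[OF S(3)[unfolded at_within_open[OF S(2,1)]]]) simp
    moreover have "((\<lambda>v :: real. (1 + v)\<^sup>2) has_real_derivative 2) (at 0)"
      by (rule derivative_eq_intros refl | simp)+
    ultimately have "(0 :: real) = 2"
      by (rule DERIV_unique)
    then show False
      by simp
  qed
  then show False
    by simp
qed

section \<open>The threat policy under control sharing\<close>

context
  fixes q
  assumes q: "control_sharing q"
begin

lemma threat_policies: "threat_policy \<in> policies threat_team q"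
proof -
  have [measurable]: "(\<lambda>x. snd x 1) \<in> info_space threat_team q 2 \<rightarrow>\<^sub>M (borel :: real measure)"
    using q by (simp add: info_space_def shared_idx_def)
  have "threat_policy i \<in> info_space threat_team q i \<rightarrow>\<^sub>M borel" for i
    by (cases "i = 2") (simp_all add: threat_policy_def[abs_def])
  then show ?thesis
    by (simp add: policies_def dm_policies_def)
qed

lemma threat_info: "snd (info threat_team q 2 z u) 1 = u 1"
  using q by (simp add: info_def shared_idx_def)

lemma play_threat_policy: "i \<in> {1, 2} \<Longrightarrow> play threat_team q threat_policy z i = 0"
proof -
  have "play threat_team q threat_policy z 1 = 0"
    using threat.play_eq[of 1 q threat_policy z] by (simp add: threat_policy_def)
  moreover from this have "play threat_team q threat_policy z 2 = 0"
    using threat.play_eq[of 2 q threat_policy z] by (simp add: threat_policy_def threat_info)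
  ultimately show "i \<in> {1, 2} \<Longrightarrow> play threat_team q threat_policy z i = 0"
    by auto
qed

text \<open>A deviating DM 1 either still plays 0 or is answered by 1, and a deviating DM 2 faces
  action 0 of DM 1. Either way the product inside the square vanishes.\<close>

lemma threat_deviation_cost:
  assumes "i \<in> {1, 2}"
  shows "(1 + play threat_team q (threat_policy(i := \<beta>)) z 1 *
     (1 - play threat_team q (threat_policy(i := \<beta>)) z 2))\<^sup>2 = 1"
proof (cases "i = 1")
  case True
  then have "play threat_team q (threat_policy(i := \<beta>)) z 2 =
      (if play threat_team q (threat_policy(i := \<beta>)) z 1 \<noteq> 0 then 1 else 0)"
    using threat.play_eq[of 2 q "threat_policy(i := \<beta>)" z] threat_info[of z]
    by (simp add: threat_policy_def)
  then show ?thesis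
    by simp
next
  case False
  then have "play threat_team q (threat_policy(i := \<beta>)) z 1 = 0"
    using threat.play_eq[of 1 q "threat_policy(i := \<beta>)" z]
    by (simp add: threat_policy_def)
  then show ?thesis
    by simp
qed

lemma threat_pbp_optimal: "pbp_optimal threat_team q threat_policy"
proof -
  have "J threat_team q threat_policy = ennreal 1"
    by (rule J_threat_team) (simp add: play_threat_policy)
  moreover have "J threat_team q (threat_policy(i := \<beta>)) = ennreal 1" if "i \<in> {1, 2}" for i \<beta>
    by (rule J_threat_team) (rule threat_deviation_cost[OF that])
  moreover have "dms threat_team = {1, 2}"
    by auto
  ultimately show ?thesis
    unfolding threat.pbp_optimal_iff by (simp add: threat_policies)
qed

text \<open>With the law of zeta itself as kernel, the conditional cost is identically 1 in the
  action of the deviating DM, so its gradient vanishes at every point.\<close>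

lemma threat_stationary: "stationary threat_team q threat_policy"
  unfolding stationary_def
proof (intro conjI ballI threat_policies)
  fix i assume i: "i \<in> dms threat_team"
  then have i': "i \<in> {1, 2}"
    by auto
  interpret prob_space "zeta_law threat_team" by (rule threat.prob_space_zeta_law)
  have "(\<integral>\<^sup>+ z'. closed_cost threat_team q (threat_policy(i := (\<lambda>_. u))) z' \<partial>zeta_law threat_team) = 1" for u
    using emeasure_space_1 threat_deviation_cost[OF i'] by (simp add: closed_cost_def)
  then have "zero_gradient UNIV UNIV
      (\<lambda>u. \<integral>\<^sup>+ z'. closed_cost threat_team q (threat_policy(i := (\<lambda>_. u))) z' \<partial>zeta_law threat_team) x" for x
    by (auto simp: zero_gradient_def intro!: exI[of _ UNIV])
  then show "\<exists>\<kappa>.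
      regular_cond_distr (zeta_law threat_team) (info_space threat_team q i)
        (closed_info threat_team q threat_policy i) \<kappa> \<and>
      (AE z in zeta_law threat_team. zero_gradient (act_euclid threat_team i) (act_set threat_team i)
        (\<lambda>u. \<integral>\<^sup>+ z'. closed_cost threat_team q (threat_policy(i := (\<lambda>_. u))) z'
           \<partial>\<kappa> (closed_info threat_team q threat_policy i z))
        (threat_policy i (closed_info threat_team q threat_policy i z)))"
    using regular_cond_distr_threat_team[OF threat.closed_info_measurable[OF threat_policies i]]
    by (intro exI[of _ "\<lambda>_. zeta_law threat_team"]) simp
qed

text \<open>On the realized play DM 1 chooses 0, so the threat is never carried out and the actions
  are those of the idle policy.\<close>

lemma same_actions_threat: "same_actions threat_team p idle_policy q threat_policy"
proof -
  have "threat_policy i (closed_info threat_team q threat_policy i z) = 0" if "i \<in> dms threat_team" for i z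
  proof -
    have "i \<in> {1, 2}"
      using that by auto
    then show ?thesis
      using threat.play_eq[OF that, of q threat_policy z] play_threat_policy
      by (simp add: closed_info_def)
  qed
  then show ?thesis
    by (simp add: same_actions_def idle_policy_def)
qed

text \<open>With \<open>p\<close> arbitrary and \<open>q\<close> any control-sharing problem, one
  team and one pair of policies covers both the dynamic and the static case.\<close>

lemma threat_counterexample:
  "\<exists>(T' :: (real, real, real, real) team) \<gamma>q \<gamma>p.
     pn_team T' \<and> invertible_obs T' \<and> \<gamma>q \<in> policies T' q \<and> \<gamma>p \<in> policies T' p \<and>
     same_actions T' p \<gamma>p q \<gamma>q \<and>
     pbp_optimal T' q \<gamma>q \<and> \<not> pbp_optimal T' p \<gamma>p"
  "\<exists>(T' :: (real, real, real, real) team) \<gamma>q \<gamma>p.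
     pn_team T' \<and> invertible_obs T' \<and> \<gamma>q \<in> policies T' q \<and> \<gamma>p \<in> policies T' p \<and>
     same_actions T' p \<gamma>p q \<gamma>q \<and>
     stationary T' q \<gamma>q \<and> \<not> stationary T' p \<gamma>p"
  using pn_team_threat_team invertible_threat_team threat_policies idle_policies same_actions_threat
    threat_pbp_optimal idle_not_pbp_optimal threat_stationary idle_not_stationary
  by blast+

end

end

theorem theorem5p2:
  fixes T :: "('w, 'z::polish_space, 'y::euclidean_space, 'u::euclidean_space) team"
  assumes "pn_team T"
  shows
    "(invertible_obs T \<longrightarrow>
       (\<forall>\<gamma>DCS\<in>policies T PDCS. \<forall>\<gamma>CS\<in>policies T PCS. cs_related T \<gamma>DCS \<gamma>CS \<longrightarrow>
          (pbp_optimal T PDCS \<gamma>DCS \<longleftrightarrow> pbp_optimal T PCS \<gamma>CS) \<and>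
          (stationary T PDCS \<gamma>DCS \<longleftrightarrow> stationary T PCS \<gamma>CS) \<and>
          (globally_optimal T PDCS \<gamma>DCS \<longleftrightarrow> globally_optimal T PCS \<gamma>CS))) \<and>
     ((\<forall>\<gamma>D\<in>policies T PD.
         (pbp_optimal T PD \<gamma>D \<longrightarrow> pbp_optimal T PDCS (ignore_controls \<gamma>D)) \<and>
         (stationary T PD \<gamma>D \<longrightarrow> stationary T PDCS (ignore_controls \<gamma>D))) \<and>
      (\<exists>(T' :: (real, real, real, real) team) \<gamma>DCS \<gamma>D.
         pn_team T' \<and> invertible_obs T' \<and> \<gamma>DCS \<in> policies T' PDCS \<and> \<gamma>D \<in> policies T' PD \<and>
         same_actions T' PD \<gamma>D PDCS \<gamma>DCS \<and>
         pbp_optimal T' PDCS \<gamma>DCS \<and> \<not> pbp_optimal T' PD \<gamma>D) \<and>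
      (\<exists>(T' :: (real, real, real, real) team) \<gamma>DCS \<gamma>D.
         pn_team T' \<and> invertible_obs T' \<and> \<gamma>DCS \<in> policies T' PDCS \<and> \<gamma>D \<in> policies T' PD \<and>
         same_actions T' PD \<gamma>D PDCS \<gamma>DCS \<and>
         stationary T' PDCS \<gamma>DCS \<and> \<not> stationary T' PD \<gamma>D)) \<and>
     ((\<forall>\<gamma>S\<in>policies T PS.
         (pbp_optimal T PS \<gamma>S \<longrightarrow> pbp_optimal T PCS (ignore_controls \<gamma>S)) \<and>
         (stationary T PS \<gamma>S \<longrightarrow> stationary T PCS (ignore_controls \<gamma>S))) \<and>
      (\<exists>(T' :: (real, real, real, real) team) \<gamma>CS \<gamma>S.
         pn_team T' \<and> invertible_obs T' \<and> \<gamma>CS \<in> policies T' PCS \<and> \<gamma>S \<in> policies T' PS \<and>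
         same_actions T' PS \<gamma>S PCS \<gamma>CS \<and>
         pbp_optimal T' PCS \<gamma>CS \<and> \<not> pbp_optimal T' PS \<gamma>S) \<and>
      (\<exists>(T' :: (real, real, real, real) team) \<gamma>CS \<gamma>S.
         pn_team T' \<and> invertible_obs T' \<and> \<gamma>CS \<in> policies T' PCS \<and> \<gamma>S \<in> policies T' PS \<and>
         same_actions T' PS \<gamma>S PCS \<gamma>CS \<and>
         stationary T' PCS \<gamma>CS \<and> \<not> stationary T' PS \<gamma>S))"
proof -
  interpret nested_team T
    by unfold_locales (rule assms)
  have sharing: "\<not> control_sharing PD" "\<not> control_sharing PS"
      "control_sharing PDCS" "control_sharing PCS"
    and dynamics: "dynamic PD = dynamic PDCS" "dynamic PS = dynamic PCS"
    by (simp_all add: control_sharing_def dynamic_def)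
  show ?thesis
  proof (intro conjI ballI impI)
    fix \<gamma>DCS \<gamma>CS
    assume *: "invertible_obs T" "\<gamma>DCS \<in> policies T PDCS" "\<gamma>CS \<in> policies T PCS"
      "cs_related T \<gamma>DCS \<gamma>CS"
    show "pbp_optimal T PDCS \<gamma>DCS \<longleftrightarrow> pbp_optimal T PCS \<gamma>CS"
      by (rule cs_pbp_optimal_iff[OF *])
    show "stationary T PDCS \<gamma>DCS \<longleftrightarrow> stationary T PCS \<gamma>CS"
      by (rule cs_stationary_iff[OF *])
    show "globally_optimal T PDCS \<gamma>DCS \<longleftrightarrow> globally_optimal T PCS \<gamma>CS"
      by (rule cs_globally_optimal_iff[OF *])
  next
    fix \<gamma>D
    show "pbp_optimal T PDCS (ignore_controls \<gamma>D)" if "pbp_optimal T PD \<gamma>D"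
      by (rule pbp_optimal_ignore_controls[OF sharing(1,3) dynamics(1) that])
    show "stationary T PDCS (ignore_controls \<gamma>D)" if "stationary T PD \<gamma>D"
      by (rule stationary_ignore_controls[OF sharing(1,3) dynamics(1) that])
  next
    fix \<gamma>S
    show "pbp_optimal T PCS (ignore_controls \<gamma>S)" if "pbp_optimal T PS \<gamma>S"
      by (rule pbp_optimal_ignore_controls[OF sharing(2,4) dynamics(2) that])
    show "stationary T PCS (ignore_controls \<gamma>S)" if "stationary T PS \<gamma>S"
      by (rule stationary_ignore_controls[OF sharing(2,4) dynamics(2) that])
  \<comment> \<open>The goals left are the four failures of the converse, two for
    \<open>PDCS\<close> and two for \<open>PCS\<close>.\<close>
  qed (rule threat_counterexample[OF sharing(3)] threat_counterexample[OF sharing(4)])+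
qed

end
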